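(* Let $\mathscr A$ be an exact category, let $\Gamma_{\mathscr A}$ be its Grothendieck monoid, $\Gamma_{\mathscr A}^+=\Gamma_{\mathscr A}\setminus\{0\}$, and let $S_{\mathscr A}\subset\mathrm{Iso}\,\mathscr A$ be the set of isomorphism classes of almost simple objects. Then the restriction of the canonical homomorphism of monoids $\mathrm{Iso}\,\mathscr A\to\Gamma_{\mathscr A}$, $[X]\mapsto|X|$, to $S_{\mathscr A}$ is a bijection $$S_{\mathscr A}\to\Gamma_{\mathscr A}^+\setminus(\Gamma_{\mathscr A}^++\Gamma_{\mathscr A}^+).$$ In particular (when $\mathscr A$ is finitary, so that the Hall algebra $H_{\mathscr A}$ is defined), $(H_{\mathscr A})_\gamma=\mathrm{Prim}(H_{\mathscr A})_\gamma$ for all $\gamma\in\Gamma_{\mathscr A}^+\setminus(\Gamma_{\mathscr A}^++\Gamma_{\mathscr A}^+)$, and this space is one-dimensional.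
   Context: All categories are essentially small; exact categories are in the sense of Quillen. $\mathrm{Iso}\,\mathscr A$ is the set of isomorphism classes $[X]$ of objects, an abelian monoid under $[X]+[Y]=[X\oplus Y]$. $\underline{\mathrm{Ext}}^1_{\mathscr A}(A,B)$ is the set of all $[X]$ such that there is a short exact sequence $B\rightarrowtail X\twoheadrightarrow A$. The Grothendieck monoid $\Gamma_{\mathscr A}$ is the quotient of $\mathrm{Iso}\,\mathscr A$ by the congruence which is the transitive closure of: $[X]\equiv[Y]$ if $[X],[Y]\in\underline{\mathrm{Ext}}^1_{\mathscr A}(M,N)$ for some $M,N$; $|X|$ is the image of $X$. An object $X\ne0$ is almost simple if $[X]\in\underline{\mathrm{Ext}}^1_{\mathscr A}(A,B)$ implies $\{[A],[B]\}=\{[X],[0]\}$. $\mathscr A$ is finitary if all Hom sets and all sets $\underline{\mathrm{Ext}}^1_{\mathscr A}(A,B)$ are finite. For $\mathscr A$ finitary, let $\mathcal E(A,B)_X$ be the set of all short exact sequences $B\rightarrowtail X\twoheadrightarrow A$ and $F_{A,B}^X=\#\mathcal E(A,B)_X/(\#\mathrm{Aut}\,A\cdot\#\mathrm{Aut}\,B)$. The Hall algebra $H_{\mathscr A}$ is the $\mathbb Q$-vector space with basis $\mathrm{Iso}\,\mathscr A$, product $[A]\cdot[B]=\sum_{[C]}F_{A,B}^C[C]$, unit $1=[0]$, graded by $\Gamma_{\mathscr A}$ via $[M]\mapsto|M|$, with the (topological) coproduct given by the possibly infinite formal sum $\Delta([C])=\sum_{[A],[B]}F^{A,B}_C\,[A]\otimes[B]$,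 $F^{A,B}_C=\frac{\#\mathrm{Aut}\,A\cdot\#\mathrm{Aut}\,B}{\#\mathrm{Aut}\,C}F_{B,A}^C$. $\mathrm{Prim}(H_{\mathscr A})=\{v:\Delta(v)=v\otimes1+1\otimes v\}$, and the subscript $\gamma$ denotes the intersection with $(H_{\mathscr A})_\gamma$. *)

theory Defs
  imports Complex_Main "HOL-Algebra.Coset" "HOL-Library.Poly_Mapping"
begin

section \<open>Additive categories\<close>

text \<open>Categories are small: objects and arrows form sets, and \<open>g \<odot> f\<close> is the composite
  "first \<open>f\<close>, then \<open>g\<close>". Operations are unspecified outside their domain.\<close>

record ('o, 'm) cat =
  Ob :: "'o set"
  Ar :: "'m set"
  Dom :: "'m \<Rightarrow> 'o"
  Cod :: "'m \<Rightarrow> 'o"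
  Idn :: "'o \<Rightarrow> 'm"
  Cmp :: "'m \<Rightarrow> 'm \<Rightarrow> 'm"  (infixl "\<odot>\<index>" 70)

definition Mor :: "('o, 'm, 'r) cat_scheme \<Rightarrow> 'o \<Rightarrow> 'o \<Rightarrow> 'm set" where
  "Mor C X Y = {f \<in> Ar C. Dom C f = X \<and> Cod C f = Y}"

locale category =
  fixes C :: "('o, 'm, 'r) cat_scheme" (structure)
  assumes Dom_in_Ob: "f \<in> Ar C \<Longrightarrow> Dom C f \<in> Ob C"
    and Cod_in_Ob: "f \<in> Ar C \<Longrightarrow> Cod C f \<in> Ob C"
    and Idn_in_Mor: "X \<in> Ob C \<Longrightarrow> Idn C X \<in> Mor C X X"
    and Cmp_in_Mor: "\<lbrakk>f \<in> Mor C X Y; g \<in> Mor C Y Z\<rbrakk> \<Longrightarrow> g \<odot> f \<in> Mor C X Z"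
    and Cmp_assoc: "\<lbrakk>f \<in> Mor C W X; g \<in> Mor C X Y; h \<in> Mor C Y Z\<rbrakk> \<Longrightarrow> (h \<odot> g) \<odot> f = h \<odot> (g \<odot> f)"
    and Cmp_Idn: "f \<in> Mor C X Y \<Longrightarrow> f \<odot> Idn C X = f"
    and Idn_Cmp: "f \<in> Mor C X Y \<Longrightarrow> Idn C Y \<odot> f = f"

definition is_iso :: "('o, 'm, 'r) cat_scheme \<Rightarrow> 'm \<Rightarrow> bool" where
  "is_iso C f \<longleftrightarrow> f \<in> Ar C \<and>
    (\<exists>g \<in> Mor C (Cod C f) (Dom C f).
       g \<odot>\<^bsub>C\<^esub> f = Idn C (Dom C f) \<and> f \<odot>\<^bsub>C\<^esub> g = Idn C (Cod C f))"

definition isomorphic :: "('o, 'm, 'r) cat_scheme \<Rightarrow> 'o \<Rightarrow> 'o \<Rightarrow> bool" where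
  "isomorphic C X Y \<longleftrightarrow> (\<exists>f \<in> Mor C X Y. is_iso C f)"

definition Aut :: "('o, 'm, 'r) cat_scheme \<Rightarrow> 'o \<Rightarrow> 'm set" where
  "Aut C X = {f \<in> Mor C X X. is_iso C f}"

definition is_zero_object :: "('o, 'm, 'r) cat_scheme \<Rightarrow> 'o \<Rightarrow> bool" where
  "is_zero_object C Z \<longleftrightarrow> Z \<in> Ob C \<and>
    (\<forall>X \<in> Ob C. (\<exists>!f. f \<in> Mor C Z X) \<and> (\<exists>!f. f \<in> Mor C X Z))"

text \<open>The square with \<open>p \<odot> f' = f \<odot> p'\<close>, where \<open>p : X \<rightarrow> A\<close>, \<open>f : A' \<rightarrow> A\<close>, \<open>f' : P \<rightarrow> X\<close>
  and \<open>p' : P \<rightarrow> A'\<close>.\<close>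

definition is_pullback :: "('o, 'm, 'r) cat_scheme \<Rightarrow> 'm \<Rightarrow> 'm \<Rightarrow> 'm \<Rightarrow> 'm \<Rightarrow> bool" where
  "is_pullback C p f f' p' \<longleftrightarrow>
    {p, f, f', p'} \<subseteq> Ar C \<and> Cod C p = Cod C f \<and> Dom C f' = Dom C p' \<and>
    Cod C f' = Dom C p \<and> Cod C p' = Dom C f \<and> p \<odot>\<^bsub>C\<^esub> f' = f \<odot>\<^bsub>C\<^esub> p' \<and>
    (\<forall>T \<in> Ob C. \<forall>u \<in> Mor C T (Dom C p). \<forall>v \<in> Mor C T (Dom C f).
       p \<odot>\<^bsub>C\<^esub> u = f \<odot>\<^bsub>C\<^esub> v \<longrightarrow>
       (\<exists>!w. w \<in> Mor C T (Dom C f') \<and> f' \<odot>\<^bsub>C\<^esub> w = u \<and> p' \<odot>\<^bsub>C\<^esub> w = v))"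

text \<open>The square with \<open>f' \<odot> i = i' \<odot> f\<close>, where \<open>i : B \<rightarrow> X\<close>, \<open>f : B \<rightarrow> B'\<close>, \<open>f' : X \<rightarrow> P\<close>
  and \<open>i' : B' \<rightarrow> P\<close>.\<close>

definition is_pushout :: "('o, 'm, 'r) cat_scheme \<Rightarrow> 'm \<Rightarrow> 'm \<Rightarrow> 'm \<Rightarrow> 'm \<Rightarrow> bool" where
  "is_pushout C i f f' i' \<longleftrightarrow>
    {i, f, f', i'} \<subseteq> Ar C \<and> Dom C i = Dom C f \<and> Cod C f' = Cod C i' \<and>
    Dom C f' = Cod C i \<and> Dom C i' = Cod C f \<and> f' \<odot>\<^bsub>C\<^esub> i = i' \<odot>\<^bsub>C\<^esub> f \<and>
    (\<forall>T \<in> Ob C. \<forall>u \<in> Mor C (Cod C i) T. \<forall>v \<in> Mor C (Cod C f) T.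
       u \<odot>\<^bsub>C\<^esub> i = v \<odot>\<^bsub>C\<^esub> f \<longrightarrow>
       (\<exists>!w. w \<in> Mor C (Cod C f') T \<and> w \<odot>\<^bsub>C\<^esub> f' = u \<and> w \<odot>\<^bsub>C\<^esub> i' = v))"

record ('o, 'm) addcat = "('o, 'm) cat" +
  Add :: "'m \<Rightarrow> 'm \<Rightarrow> 'm"
  Zro :: "'o \<Rightarrow> 'o \<Rightarrow> 'm"

definition Mor_group :: "('o, 'm, 'r) addcat_scheme \<Rightarrow> 'o \<Rightarrow> 'o \<Rightarrow> 'm monoid" where
  "Mor_group C X Y = \<lparr>carrier = Mor C X Y, monoid.mult = Add C, one = Zro C X Y\<rparr>"

definition is_biproduct ::
    "('o, 'm, 'r) addcat_scheme \<Rightarrow> 'o \<Rightarrow> 'o \<Rightarrow> 'o \<Rightarrow> 'm \<Rightarrow> 'm \<Rightarrow> 'm \<Rightarrow> 'm \<Rightarrow> bool" where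
  "is_biproduct C A B S iA iB pA pB \<longleftrightarrow> {A, B, S} \<subseteq> Ob C \<and>
    iA \<in> Mor C A S \<and> iB \<in> Mor C B S \<and> pA \<in> Mor C S A \<and> pB \<in> Mor C S B \<and>
    pA \<odot>\<^bsub>C\<^esub> iA = Idn C A \<and> pB \<odot>\<^bsub>C\<^esub> iB = Idn C B \<and>
    pA \<odot>\<^bsub>C\<^esub> iB = Zro C B A \<and> pB \<odot>\<^bsub>C\<^esub> iA = Zro C A B \<and>
    Add C (iA \<odot>\<^bsub>C\<^esub> pA) (iB \<odot>\<^bsub>C\<^esub> pB) = Idn C S"

definition is_kernel :: "('o, 'm, 'r) addcat_scheme \<Rightarrow> 'm \<Rightarrow> 'm \<Rightarrow> bool" where
  "is_kernel C k f \<longleftrightarrow> k \<in> Ar C \<and> f \<in> Ar C \<and> Cod C k = Dom C f \<and>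
    f \<odot>\<^bsub>C\<^esub> k = Zro C (Dom C k) (Cod C f) \<and>
    (\<forall>T \<in> Ob C. \<forall>u \<in> Mor C T (Dom C f). f \<odot>\<^bsub>C\<^esub> u = Zro C T (Cod C f) \<longrightarrow>
       (\<exists>!w. w \<in> Mor C T (Dom C k) \<and> k \<odot>\<^bsub>C\<^esub> w = u))"

definition is_cokernel :: "('o, 'm, 'r) addcat_scheme \<Rightarrow> 'm \<Rightarrow> 'm \<Rightarrow> bool" where
  "is_cokernel C q f \<longleftrightarrow> q \<in> Ar C \<and> f \<in> Ar C \<and> Cod C f = Dom C q \<and>
    q \<odot>\<^bsub>C\<^esub> f = Zro C (Dom C f) (Cod C q) \<and>
    (\<forall>T \<in> Ob C. \<forall>u \<in> Mor C (Cod C f) T. u \<odot>\<^bsub>C\<^esub> f = Zro C (Dom C f) T \<longrightarrow>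
       (\<exists>!w. w \<in> Mor C (Cod C q) T \<and> w \<odot>\<^bsub>C\<^esub> q = u))"

locale additive_category = category C
  for C :: "('o, 'm, 'r) addcat_scheme" (structure) +
  assumes Mor_comm_group: "\<lbrakk>X \<in> Ob C; Y \<in> Ob C\<rbrakk> \<Longrightarrow> comm_group (Mor_group C X Y)"
    and Cmp_Add: "\<lbrakk>f \<in> Mor C X Y; g \<in> Mor C X Y; h \<in> Mor C Y Z\<rbrakk> \<Longrightarrow>
          h \<odot> Add C f g = Add C (h \<odot> f) (h \<odot> g)"
    and Add_Cmp: "\<lbrakk>f \<in> Mor C X Y; g \<in> Mor C Y Z; h \<in> Mor C Y Z\<rbrakk> \<Longrightarrow>
          Add C g h \<odot> f = Add C (g \<odot> f) (h \<odot> f)"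
    and ex_zero_object: "\<exists>Z. is_zero_object C Z"
    and ex_biproduct: "\<lbrakk>A \<in> Ob C; B \<in> Ob C\<rbrakk> \<Longrightarrow>
          \<exists>S iA iB pA pB. is_biproduct C A B S iA iB pA pB"


section \<open>Exact categories\<close>

text \<open>\<open>(i, j) \<in> Ses C\<close> means that \<open>i\<close> followed by \<open>j\<close> is one of the distinguished short exact
  sequences.\<close>

record ('o, 'm) excat = "('o, 'm) addcat" +
  Ses :: "('m \<times> 'm) set"

definition adm_mono :: "('o, 'm, 'r) excat_scheme \<Rightarrow> 'm \<Rightarrow> bool" where
  "adm_mono C i \<longleftrightarrow> (\<exists>j. (i, j) \<in> Ses C)"

definition adm_epi :: "('o, 'm, 'r) excat_scheme \<Rightarrow> 'm \<Rightarrow> bool" where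
  "adm_epi C j \<longleftrightarrow> (\<exists>i. (i, j) \<in> Ses C)"

text \<open>Quillen's original axioms. The last two, on maps with a (co)kernel, are known to follow from
  the others (Keller).\<close>

locale exact_category = additive_category C
  for C :: "('o, 'm, 'r) excat_scheme" (structure) +
  assumes Ses_kernel: "(i, j) \<in> Ses C \<Longrightarrow> is_kernel C i j"
    and Ses_cokernel: "(i, j) \<in> Ses C \<Longrightarrow> is_cokernel C j i"
    and Ses_iso: "\<lbrakk>(i, j) \<in> Ses C; i' \<in> Mor C B' X'; j' \<in> Mor C X' A';
          b \<in> Mor C (Dom C i) B'; x \<in> Mor C (Cod C i) X'; a \<in> Mor C (Cod C j) A';
          is_iso C b; is_iso C x; is_iso C a; x \<odot> i = i' \<odot> b; a \<odot> j = j' \<odot> x\<rbrakk> \<Longrightarrow>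
          (i', j') \<in> Ses C"
    and Ses_split: "is_biproduct C A B S iA iB pA pB \<Longrightarrow> (iA, pB) \<in> Ses C"
    and adm_epi_Cmp: "\<lbrakk>adm_epi C f; adm_epi C g; Dom C g = Cod C f\<rbrakk> \<Longrightarrow> adm_epi C (g \<odot> f)"
    and adm_epi_base_change: "\<lbrakk>adm_epi C p; f \<in> Ar C; Cod C f = Cod C p\<rbrakk> \<Longrightarrow>
          \<exists>f' p'. is_pullback C p f f' p' \<and> adm_epi C p'"
    and adm_mono_Cmp: "\<lbrakk>adm_mono C f; adm_mono C g; Dom C g = Cod C f\<rbrakk> \<Longrightarrow> adm_mono C (g \<odot> f)"
    and adm_mono_cobase_change: "\<lbrakk>adm_mono C i; f \<in> Ar C; Dom C f = Dom C i\<rbrakk> \<Longrightarrow>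
          \<exists>f' i'. is_pushout C i f f' i' \<and> adm_mono C i'"
    and adm_epi_cancel: "\<lbrakk>is_kernel C k f; g \<in> Ar C; Cod C g = Dom C f; adm_epi C (f \<odot> g)\<rbrakk> \<Longrightarrow>
          adm_epi C f"
    and adm_mono_cancel: "\<lbrakk>is_cokernel C q f; g \<in> Ar C; Dom C g = Cod C f; adm_mono C (g \<odot> f)\<rbrakk> \<Longrightarrow>
          adm_mono C f"

text \<open>The set \<open>\<E>(A,B)\<^sub>X\<close>; sequences end in \<open>A\<close> and start in \<open>B\<close>.\<close>

definition Seqs :: "('o, 'm, 'r) excat_scheme \<Rightarrow> 'o \<Rightarrow> 'o \<Rightarrow> 'o \<Rightarrow> ('m \<times> 'm) set" where
  "Seqs C A B X = {(i, j) \<in> Ses C. i \<in> Mor C B X \<and> j \<in> Mor C X A}"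


section \<open>The monoid of isomorphism classes and the Grothendieck monoid\<close>

definition isoclass :: "('o, 'm, 'r) cat_scheme \<Rightarrow> 'o \<Rightarrow> 'o set" where
  "isoclass C X = {Y \<in> Ob C. isomorphic C X Y}"

definition zero_class :: "('o, 'm, 'r) cat_scheme \<Rightarrow> 'o set" where
  "zero_class C = {Z. is_zero_object C Z}"

text \<open>Biproducts being unique up to isomorphism, the product of two classes, i.e. the set of all
  biproducts of representatives, is a single isomorphism class. Both monoids of this section are
  written multiplicatively, following HOL-Algebra.\<close>

definition Iso :: "('o, 'm, 'r) addcat_scheme \<Rightarrow> 'o set monoid" where
  "Iso C = \<lparr>carrier = isoclass C ` Ob C,
     monoid.mult = (\<lambda>x y. {S. \<exists>A \<in> x. \<exists>B \<in> y. \<exists>iA iB pA pB. is_biproduct C A B S iA iB pA pB}),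
     one = zero_class C\<rparr>"

definition Ext1 :: "('o, 'm, 'r) excat_scheme \<Rightarrow> 'o \<Rightarrow> 'o \<Rightarrow> 'o set set" where
  "Ext1 C A B = {isoclass C X |X. X \<in> Ob C \<and> Seqs C A B X \<noteq> {}}"

definition Groth_cong :: "('o, 'm, 'r) excat_scheme \<Rightarrow> 'o set rel" where
  "Groth_cong C = {(x, y). \<exists>M \<in> Ob C. \<exists>N \<in> Ob C. x \<in> Ext1 C M N \<and> y \<in> Ext1 C M N}\<^sup>+"

definition Groth_class :: "('o, 'm, 'r) excat_scheme \<Rightarrow> 'o set \<Rightarrow> 'o set set" where
  "Groth_class C x = Groth_cong C `` {x}"

text \<open>The product of two congruence classes is written as a union over all representatives, as usual
  for operations on quotients; all terms of the union coincide.\<close>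

definition Groth :: "('o, 'm, 'r) excat_scheme \<Rightarrow> 'o set set monoid" where
  "Groth C = \<lparr>carrier = carrier (Iso C) // Groth_cong C,
     monoid.mult = (\<lambda>\<gamma> \<delta>. \<Union>x \<in> \<gamma>. \<Union>y \<in> \<delta>. Groth_class C (x \<otimes>\<^bsub>Iso C\<^esub> y)),
     one = Groth_class C \<one>\<^bsub>Iso C\<^esub>\<rparr>"

definition Groth_pos :: "('o, 'm, 'r) excat_scheme \<Rightarrow> 'o set set set" where
  "Groth_pos C = carrier (Groth C) - {\<one>\<^bsub>Groth C\<^esub>}"

definition almost_simple :: "('o, 'm, 'r) excat_scheme \<Rightarrow> 'o \<Rightarrow> bool" where
  "almost_simple C X \<longleftrightarrow> X \<in> Ob C \<and> \<not> is_zero_object C X \<and>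
    (\<forall>A \<in> Ob C. \<forall>B \<in> Ob C. isoclass C X \<in> Ext1 C A B \<longrightarrow>
       {isoclass C A, isoclass C B} = {isoclass C X, zero_class C})"

definition almost_simple_classes :: "('o, 'm, 'r) excat_scheme \<Rightarrow> 'o set set" where
  "almost_simple_classes C = isoclass C ` {X. almost_simple C X}"

definition finitary :: "('o, 'm, 'r) excat_scheme \<Rightarrow> bool" where
  "finitary C \<longleftrightarrow> (\<forall>A \<in> Ob C. \<forall>B \<in> Ob C. finite (Mor C A B) \<and> finite (Ext1 C A B))"


section \<open>The Hall algebra\<close>

text \<open>Structure constants depend only on isomorphism classes, hence the choice of representatives is
  immaterial.\<close>

definition rep :: "'o set \<Rightarrow> 'o" where
  "rep x = (SOME X. X \<in> x)"

definition Hall_num :: "('o, 'm, 'r) excat_scheme \<Rightarrow> 'o set \<Rightarrow> 'o set \<Rightarrow> 'o set \<Rightarrow> rat" where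
  "Hall_num C a b c = of_nat (card (Seqs C (rep a) (rep b) (rep c))) /
     (of_nat (card (Aut C (rep a))) * of_nat (card (Aut C (rep b))))"

definition dual_Hall_num :: "('o, 'm, 'r) excat_scheme \<Rightarrow> 'o set \<Rightarrow> 'o set \<Rightarrow> 'o set \<Rightarrow> rat" where
  "dual_Hall_num C a b c =
     of_nat (card (Aut C (rep a))) * of_nat (card (Aut C (rep b))) / of_nat (card (Aut C (rep c))) *
     Hall_num C b a c"

text \<open>A finitely supported function \<open>v\<close> on isomorphism classes is the linear combination of
  the basis vectors \<open>x\<close> with coefficients \<open>lookup v x\<close>.\<close>

definition Hall_scale :: "rat \<Rightarrow> ('x \<Rightarrow>\<^sub>0 rat) \<Rightarrow> ('x \<Rightarrow>\<^sub>0 rat)" where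
  "Hall_scale q v = Poly_Mapping.map ((*) q) v"

lemma lookup_Hall_scale [simp]:
  "Poly_Mapping.lookup (Hall_scale q v) x = q * Poly_Mapping.lookup v x"
  by (simp add: Hall_scale_def Poly_Mapping.map.rep_eq when_def)

global_interpretation Hall: vector_space Hall_scale
  by unfold_locales (auto intro!: poly_mapping_eqI simp: lookup_add algebra_simps)

definition Hall :: "('o, 'm, 'r) excat_scheme \<Rightarrow> ('o set \<Rightarrow>\<^sub>0 rat) set" where
  "Hall C = {v. Poly_Mapping.keys v \<subseteq> carrier (Iso C)}"

definition Hall_mult ::
    "('o, 'm, 'r) excat_scheme \<Rightarrow> ('o set \<Rightarrow>\<^sub>0 rat) \<Rightarrow> ('o set \<Rightarrow>\<^sub>0 rat) \<Rightarrow> ('o set \<Rightarrow>\<^sub>0 rat)" where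
  "Hall_mult C v w = (\<Sum>a \<in> Poly_Mapping.keys v. \<Sum>b \<in> Poly_Mapping.keys w.
     \<Sum>c \<in> Ext1 C (rep a) (rep b).
       Poly_Mapping.single c
         (Poly_Mapping.lookup v a * Poly_Mapping.lookup w b * Hall_num C a b c))"

definition Hall_one :: "('o, 'm, 'r) excat_scheme \<Rightarrow> ('o set \<Rightarrow>\<^sub>0 rat)" where
  "Hall_one C = Poly_Mapping.single \<one>\<^bsub>Iso C\<^esub> 1"

definition Hall_graded ::
    "('o, 'm, 'r) excat_scheme \<Rightarrow> 'o set set \<Rightarrow> ('o set \<Rightarrow>\<^sub>0 rat) set" where
  "Hall_graded C \<gamma> = {v \<in> Hall C. \<forall>x \<in> Poly_Mapping.keys v. Groth_class C x = \<gamma>}"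

text \<open>A possibly infinite formal sum of elements \<open>a \<otimes> b\<close>, with \<open>a\<close> and \<open>b\<close> isomorphism classes, is
  represented by its coefficient function.\<close>

definition Hall_tensor :: "('x \<Rightarrow>\<^sub>0 rat) \<Rightarrow> ('x \<Rightarrow>\<^sub>0 rat) \<Rightarrow> 'x \<times> 'x \<Rightarrow> rat" where
  "Hall_tensor v w = (\<lambda>(a, b). Poly_Mapping.lookup v a * Poly_Mapping.lookup w b)"

definition Hall_comult ::
    "('o, 'm, 'r) excat_scheme \<Rightarrow> ('o set \<Rightarrow>\<^sub>0 rat) \<Rightarrow> 'o set \<times> 'o set \<Rightarrow> rat" where
  "Hall_comult C v = (\<lambda>(a, b).
     if a \<in> carrier (Iso C) \<and> b \<in> carrier (Iso C)
     then \<Sum>c \<in> Poly_Mapping.keys v. Poly_Mapping.lookup v c * dual_Hall_num C a b c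
     else 0)"

definition Hall_Prim :: "('o, 'm, 'r) excat_scheme \<Rightarrow> ('o set \<Rightarrow>\<^sub>0 rat) set" where
  "Hall_Prim C = {v \<in> Hall C. Hall_comult C v =
     (\<lambda>p. Hall_tensor v (Hall_one C) p + Hall_tensor (Hall_one C) v p)}"

definition Hall_Prim_graded ::
    "('o, 'm, 'r) excat_scheme \<Rightarrow> 'o set set \<Rightarrow> ('o set \<Rightarrow>\<^sub>0 rat) set" where
  "Hall_Prim_graded C \<gamma> = Hall_Prim C \<inter> Hall_graded C \<gamma>"

end

theory Submission
  imports Defs
begin

text \<open>If \<open>X\<close> is almost simple, then \<open>[X]\<close> lies only in \<open>Ext\<^sup>1(X, 0)\<close> and \<open>Ext\<^sup>1(0, X)\<close>, which contain
  nothing else. So \<open>[X]\<close> is alone in its class in the Grothendieck monoid, and a decomposition of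
  \<open>|X|\<close> would give a decomposition \<open>X \<cong> A \<oplus> B\<close>. Likewise \<open>[0]\<close> is alone in its class. Conversely,
  \<open>[X] \<in> Ext\<^sup>1(A, B)\<close> gives \<open>|X| = |A| + |B|\<close>, so if \<open>|X|\<close> is indecomposable then \<open>|A|\<close> or \<open>|B|\<close> is
  trivial, hence \<open>A\<close> or \<open>B\<close> is zero. For such \<open>\<gamma> = |X|\<close> the graded part of the Hall algebra is spanned
  by \<open>[X]\<close>, and the two sequences \<open>X \<rightarrow> X \<rightarrow> 0\<close> and \<open>0 \<rightarrow> X \<rightarrow> X\<close> (each occurring once per automorphism
  of \<open>X\<close>) account for the two terms of \<open>\<Delta>([X])\<close>.\<close>

section \<open>Categories\<close>

context category
begin

lemma Mor_iff: "f \<in> Mor C X Y \<longleftrightarrow> f \<in> Ar C \<and> Dom C f = X \<and> Cod C f = Y"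
  by (auto simp: Mor_def)

lemma Idn_arrow [simp]:
  assumes "X \<in> Ob C"
  shows "Idn C X \<in> Ar C" "Dom C (Idn C X) = X" "Cod C (Idn C X) = X"
  using Idn_in_Mor[OF assms] by (auto simp: Mor_iff)

lemma Cmp_arrow [simp]:
  assumes "f \<in> Ar C" "g \<in> Ar C" "Dom C g = Cod C f"
  shows "g \<odot> f \<in> Ar C" "Dom C (g \<odot> f) = Dom C f" "Cod C (g \<odot> f) = Cod C g"
  using Cmp_in_Mor[of f "Dom C f" "Cod C f" g "Cod C g"] assms by (auto simp: Mor_iff)

lemma Cmp_assoc_arrow [simp]:
  assumes "f \<in> Ar C" "g \<in> Ar C" "h \<in> Ar C" "Dom C g = Cod C f" "Dom C h = Cod C g"
  shows "(h \<odot> g) \<odot> f = h \<odot> (g \<odot> f)"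
  using Cmp_assoc[of f "Dom C f" "Cod C f" g "Cod C g" h "Cod C h"] assms by (auto simp: Mor_iff)

lemma Cmp_Idn_arrow [simp]: "\<lbrakk>f \<in> Ar C; Dom C f = X\<rbrakk> \<Longrightarrow> f \<odot> Idn C X = f"
  using Cmp_Idn[of f] by (auto simp: Mor_iff)

lemma Idn_Cmp_arrow [simp]: "\<lbrakk>f \<in> Ar C; Cod C f = X\<rbrakk> \<Longrightarrow> Idn C X \<odot> f = f"
  using Idn_Cmp[of f] by (auto simp: Mor_iff)

text \<open>Composites are kept nested to the right, where \<open>g \<odot> f\<close> is no longer a
  subterm of \<open>g \<odot> (f \<odot> h)\<close>. This form makes a known value of
  \<open>g \<odot> f\<close> applicable there.\<close>

lemma Cmp_reassoc:
  assumes "g \<odot> f = e" "f \<in> Ar C" "g \<in> Ar C" "h \<in> Ar C" "Dom C g = Cod C f" "Dom C f = Cod C h"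
  shows "g \<odot> (f \<odot> h) = e \<odot> h"
  using assms Cmp_assoc_arrow[of h f g] by simp

lemma is_isoI:
  assumes "f \<in> Mor C X Y" "g \<in> Mor C Y X" "g \<odot> f = Idn C X" "f \<odot> g = Idn C Y"
  shows "is_iso C f"
  using assms by (auto simp: is_iso_def Mor_iff)

lemma is_isoE:
  assumes "is_iso C f" "f \<in> Mor C X Y"
  obtains g where "g \<in> Mor C Y X" "g \<odot> f = Idn C X" "f \<odot> g = Idn C Y"
  using assms by (auto simp: is_iso_def Mor_iff)

lemma is_iso_Idn: "X \<in> Ob C \<Longrightarrow> is_iso C (Idn C X)"
  by (rule is_isoI[of _ X X "Idn C X"]) (auto simp: Mor_iff)

lemma isomorphicI:
  assumes "f \<in> Mor C X Y" "g \<in> Mor C Y X" "g \<odot> f = Idn C X" "f \<odot> g = Idn C Y"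
  shows "isomorphic C X Y"
  using assms is_isoI[OF assms] by (auto simp: isomorphic_def)

lemma isomorphicE:
  assumes "isomorphic C X Y"
  obtains f g where "f \<in> Mor C X Y" "g \<in> Mor C Y X" "g \<odot> f = Idn C X" "f \<odot> g = Idn C Y"
  using assms by (auto simp: isomorphic_def elim: is_isoE)

lemma isomorphic_Ob: "isomorphic C X Y \<Longrightarrow> X \<in> Ob C \<and> Y \<in> Ob C"
  by (auto simp: isomorphic_def Mor_iff intro: Dom_in_Ob Cod_in_Ob)

lemma isomorphic_refl: "X \<in> Ob C \<Longrightarrow> isomorphic C X X"
  by (auto simp: isomorphic_def Mor_iff intro!: bexI[of _ "Idn C X"] is_iso_Idn)

lemma isomorphic_sym: "isomorphic C X Y \<Longrightarrow> isomorphic C Y X"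
  by (meson isomorphicE isomorphicI)

lemma isomorphic_trans:
  assumes "isomorphic C X Y" "isomorphic C Y Z"
  shows "isomorphic C X Z"
proof -
  obtain f g where fg: "f \<in> Mor C X Y" "g \<in> Mor C Y X" "g \<odot> f = Idn C X" "f \<odot> g = Idn C Y"
    using assms(1) by (rule isomorphicE)
  obtain h k where hk: "h \<in> Mor C Y Z" "k \<in> Mor C Z Y" "k \<odot> h = Idn C Y" "h \<odot> k = Idn C Z"
    using assms(2) by (rule isomorphicE)
  have "f \<odot> (g \<odot> k) = k" "k \<odot> (h \<odot> f) = f"
    using fg hk Cmp_reassoc[of f g "Idn C Y" k] Cmp_reassoc[of k h "Idn C Y" f]
    by (auto simp: Mor_iff)
  then show ?thesis
    using fg hk by (intro isomorphicI[of "h \<odot> f" _ _ "g \<odot> k"]) (auto simp: Mor_iff)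
qed

lemma self_in_isoclass: "X \<in> Ob C \<Longrightarrow> X \<in> isoclass C X"
  by (simp add: isoclass_def isomorphic_refl)

lemma isoclass_eq_iff:
  assumes "X \<in> Ob C" "Y \<in> Ob C"
  shows "isoclass C X = isoclass C Y \<longleftrightarrow> isomorphic C X Y"
  using assms self_in_isoclass[of Y]
  by (auto simp: isoclass_def intro: isomorphic_trans isomorphic_sym)

text \<open>Hall numbers are computed on chosen representatives; this ties the choice made by
  \<open>rep\<close> back to the class it comes from.\<close>

lemma isoclass_rep:
  assumes "x \<in> isoclass C ` Ob C"
  shows "rep x \<in> Ob C" "isoclass C (rep x) = x"
proof -
  obtain X where X: "X \<in> Ob C" "x = isoclass C X" using assms by auto
  have "rep x \<in> x"
    unfolding rep_def using X self_in_isoclass by (metis someI_ex)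
  then have r: "rep x \<in> Ob C" "isomorphic C X (rep x)" using X by (auto simp: isoclass_def)
  then show "rep x \<in> Ob C" by simp
  show "isoclass C (rep x) = x" using r X isoclass_eq_iff isomorphic_sym by metis
qed

end

section \<open>Additive categories\<close>

context additive_category
begin

lemma Add_arrow [simp]:
  assumes "f \<in> Ar C" "g \<in> Ar C" "Dom C f = Dom C g" "Cod C f = Cod C g"
  shows "Add C f g \<in> Ar C" "Dom C (Add C f g) = Dom C g" "Cod C (Add C f g) = Cod C g"
proof -
  interpret G: comm_group "Mor_group C (Dom C g) (Cod C g)"
    using assms by (intro Mor_comm_group Dom_in_Ob Cod_in_Ob)
  have "Add C f g \<in> Mor C (Dom C g) (Cod C g)"
    using G.m_closed[of f g] assms by (simp add: Mor_group_def Mor_iff)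
  then show "Add C f g \<in> Ar C" "Dom C (Add C f g) = Dom C g" "Cod C (Add C f g) = Cod C g"
    by (auto simp: Mor_iff)
qed

lemma Zro_arrow [simp]:
  assumes "X \<in> Ob C" "Y \<in> Ob C"
  shows "Zro C X Y \<in> Ar C" "Dom C (Zro C X Y) = X" "Cod C (Zro C X Y) = Y"
proof -
  interpret G: comm_group "Mor_group C X Y"
    using assms by (rule Mor_comm_group)
  have "Zro C X Y \<in> Mor C X Y"
    using G.one_closed by (simp add: Mor_group_def)
  then show "Zro C X Y \<in> Ar C" "Dom C (Zro C X Y) = X" "Cod C (Zro C X Y) = Y"
    by (auto simp: Mor_iff)
qed

lemma Add_Zro [simp]:
  assumes "f \<in> Ar C" "Dom C f = X" "Cod C f = Y"
  shows "Add C f (Zro C X Y) = f" "Add C (Zro C X Y) f = f"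
proof -
  interpret G: comm_group "Mor_group C X Y"
    using assms by (auto intro: Mor_comm_group Dom_in_Ob Cod_in_Ob)
  show "Add C f (Zro C X Y) = f" "Add C (Zro C X Y) f = f"
    using G.r_one[of f] G.l_one[of f] assms by (simp_all add: Mor_group_def Mor_iff)
qed

lemma Add_commute:
  assumes "f \<in> Ar C" "g \<in> Ar C" "Dom C f = Dom C g" "Cod C f = Cod C g"
  shows "Add C f g = Add C g f"
proof -
  interpret G: comm_group "Mor_group C (Dom C g) (Cod C g)"
    using assms by (intro Mor_comm_group Dom_in_Ob Cod_in_Ob)
  show ?thesis
    using G.m_comm[of f g] assms by (simp add: Mor_group_def Mor_iff)
qed

text \<open>Cancellation in the hom group. Its purpose is to show that composites with a zero arrow
  vanish.\<close>

lemma Add_self_imp_Zro: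
  assumes "f \<in> Mor C X Y" "Add C f f = f"
  shows "f = Zro C X Y"
proof -
  interpret G: comm_group "Mor_group C X Y"
    using assms by (auto simp: Mor_iff intro!: Mor_comm_group Dom_in_Ob Cod_in_Ob)
  show ?thesis
    using G.r_cancel_one'[of f f] assms by (simp add: Mor_group_def)
qed

lemma Cmp_Add_arrow [simp]:
  assumes "f \<in> Ar C" "g \<in> Ar C" "h \<in> Ar C" "Dom C f = Dom C g" "Cod C f = Cod C g" "Dom C h = Cod C g"
  shows "h \<odot> Add C f g = Add C (h \<odot> f) (h \<odot> g)"
  using assms by (auto intro!: Cmp_Add simp: Mor_iff)

lemma Add_Cmp_arrow [simp]:
  assumes "f \<in> Ar C" "g \<in> Ar C" "h \<in> Ar C" "Dom C g = Dom C h" "Cod C g = Cod C h" "Dom C h = Cod C f"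
  shows "Add C g h \<odot> f = Add C (g \<odot> f) (h \<odot> f)"
  using assms by (auto intro!: Add_Cmp simp: Mor_iff)

lemma Cmp_Zro [simp]:
  assumes "h \<in> Ar C" "Dom C h = Y" "X \<in> Ob C"
  shows "h \<odot> Zro C X Y = Zro C X (Cod C h)"
proof (rule Add_self_imp_Zro)
  have [simp]: "Y \<in> Ob C" using assms Dom_in_Ob by blast
  show "h \<odot> Zro C X Y \<in> Mor C X (Cod C h)" using assms by (simp add: Mor_iff)
  \<comment> \<open>Distributivity applied to 0 = 0 + 0.\<close>
  show "Add C (h \<odot> Zro C X Y) (h \<odot> Zro C X Y) = h \<odot> Zro C X Y"
    using assms Cmp_Add_arrow[of "Zro C X Y" "Zro C X Y" h] by simp
qed

lemma Zro_Cmp [simp]: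
  assumes "h \<in> Ar C" "Cod C h = Y" "Z \<in> Ob C"
  shows "Zro C Y Z \<odot> h = Zro C (Dom C h) Z"
proof (rule Add_self_imp_Zro)
  have [simp]: "Y \<in> Ob C" using assms Cod_in_Ob by blast
  show "Zro C Y Z \<odot> h \<in> Mor C (Dom C h) Z" using assms by (simp add: Mor_iff)
  show "Add C (Zro C Y Z \<odot> h) (Zro C Y Z \<odot> h) = Zro C Y Z \<odot> h"
    using assms Add_Cmp_arrow[of h "Zro C Y Z" "Zro C Y Z"] by simp
qed

text \<open>If the identity of \<open>X\<close> is zero, every arrow into or out of \<open>X\<close>
  is its own composite with a zero arrow, hence zero. The criterion replaces the two universal
  properties by one equation.\<close>

lemma is_zero_object_iff: "is_zero_object C X \<longleftrightarrow> X \<in> Ob C \<and> Idn C X = Zro C X X"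
proof
  assume X: "is_zero_object C X"
  then have "X \<in> Ob C" by (simp add: is_zero_object_def)
  moreover from this have "\<exists>!f. f \<in> Mor C X X" using X by (simp add: is_zero_object_def)
  ultimately show "X \<in> Ob C \<and> Idn C X = Zro C X X"
    by (auto simp: Mor_iff)
next
  assume X: "X \<in> Ob C \<and> Idn C X = Zro C X X"
  have "\<exists>!f. f \<in> Mor C X Y" "\<exists>!f. f \<in> Mor C Y X" if "Y \<in> Ob C" for Y
  proof -
    have "f = Zro C X Y" if "f \<in> Mor C X Y" for f
      using that X Cmp_Idn_arrow[of f X] by (auto simp: Mor_iff)
    then show "\<exists>!f. f \<in> Mor C X Y" using X that by (intro ex1I[of _ "Zro C X Y"]) (auto simp: Mor_iff)
    have "f = Zro C Y X" if "f \<in> Mor C Y X" for f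
      using that X Idn_Cmp_arrow[of f X] by (auto simp: Mor_iff)
    then show "\<exists>!f. f \<in> Mor C Y X" using X that by (intro ex1I[of _ "Zro C Y X"]) (auto simp: Mor_iff)
  qed
  with X show "is_zero_object C X" by (auto simp: is_zero_object_def)
qed

lemma Mor_from_zero_object:
  assumes "is_zero_object C Z" "f \<in> Mor C Z Y"
  shows "f = Zro C Z Y"
proof -
  have "Z \<in> Ob C" "Y \<in> Ob C" using assms Cod_in_Ob by (auto simp: is_zero_object_def Mor_iff)
  then show ?thesis using assms Zro_arrow[of Z Y] unfolding is_zero_object_def by (metis Mor_iff)
qed

lemma Mor_to_zero_object:
  assumes "is_zero_object C Z" "f \<in> Mor C Y Z"
  shows "f = Zro C Y Z"
proof -
  have "Z \<in> Ob C" "Y \<in> Ob C" using assms Dom_in_Ob by (auto simp: is_zero_object_def Mor_iff)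
  then show ?thesis using assms Zro_arrow[of Y Z] unfolding is_zero_object_def by (metis Mor_iff)
qed

text \<open>Zero objects form one full isomorphism class: any two are linked by zero arrows, which
  are mutually inverse, and an object isomorphic to a zero object has zero identity.\<close>

lemma isoclass_zero_object:
  assumes "is_zero_object C Z"
  shows "isoclass C Z = zero_class C"
proof -
  have [simp]: "Z \<in> Ob C" and Z: "Idn C Z = Zro C Z Z" using assms by (auto simp: is_zero_object_iff)
  have "is_zero_object C Y" if "isomorphic C Z Y" for Y
  proof -
    have [simp]: "Y \<in> Ob C" using that isomorphic_Ob by blast
    obtain f g where fg: "f \<in> Mor C Z Y" "g \<in> Mor C Y Z" "f \<odot> g = Idn C Y"
      using \<open>isomorphic C Z Y\<close> by (rule isomorphicE)
    have "f = Zro C Z Y" using fg assms Mor_from_zero_object by blast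
    then show ?thesis using fg by (auto simp: is_zero_object_iff Mor_iff)
  qed
  moreover have "isomorphic C Z Y" if "is_zero_object C Y" for Y
  proof -
    have [simp]: "Y \<in> Ob C" and Y: "Idn C Y = Zro C Y Y"
      using that by (auto simp: is_zero_object_iff)
    show ?thesis
      by (rule isomorphicI[of "Zro C Z Y" _ _ "Zro C Y Z"]) (simp_all add: Mor_iff Y Z)
  qed
  ultimately show ?thesis
    unfolding isoclass_def zero_class_def using isomorphic_Ob by blast
qed

lemma isoclass_eq_zero_class_iff:
  assumes "X \<in> Ob C"
  shows "isoclass C X = zero_class C \<longleftrightarrow> is_zero_object C X"
  using assms isoclass_zero_object[of X] self_in_isoclass[of X] by (auto simp: zero_class_def)

lemma zero_class_in_Iso: "zero_class C \<in> isoclass C ` Ob C"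
  using ex_zero_object isoclass_zero_object by (metis image_eqI is_zero_object_def)

section \<open>Biproducts and the sum of isomorphism classes\<close>

lemma is_biproduct_arrows:
  assumes "is_biproduct C A B S iA iB pA pB"
  shows "A \<in> Ob C" "B \<in> Ob C" "S \<in> Ob C"
    "iA \<in> Ar C" "Dom C iA = A" "Cod C iA = S" "iB \<in> Ar C" "Dom C iB = B" "Cod C iB = S"
    "pA \<in> Ar C" "Dom C pA = S" "Cod C pA = A" "pB \<in> Ar C" "Dom C pB = S" "Cod C pB = B"
  using assms by (auto simp: is_biproduct_def Mor_iff)

text \<open>The last five equations are the first five precomposed with an arrow \<open>h\<close>,
  the shape in which they occur in right-nested composites.\<close>

lemma is_biproduct_Cmp:
  assumes bip: "is_biproduct C A B S iA iB pA pB"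
  shows "pA \<odot> iA = Idn C A" "pB \<odot> iB = Idn C B" "pA \<odot> iB = Zro C B A" "pB \<odot> iA = Zro C A B"
    "Add C (iA \<odot> pA) (iB \<odot> pB) = Idn C S"
    "\<lbrakk>h \<in> Ar C; Cod C h = A\<rbrakk> \<Longrightarrow> pA \<odot> (iA \<odot> h) = h"
    "\<lbrakk>h \<in> Ar C; Cod C h = B\<rbrakk> \<Longrightarrow> pB \<odot> (iB \<odot> h) = h"
    "\<lbrakk>h \<in> Ar C; Cod C h = B\<rbrakk> \<Longrightarrow> pA \<odot> (iB \<odot> h) = Zro C (Dom C h) A"
    "\<lbrakk>h \<in> Ar C; Cod C h = A\<rbrakk> \<Longrightarrow> pB \<odot> (iA \<odot> h) = Zro C (Dom C h) B"
    "\<lbrakk>h \<in> Ar C; Cod C h = S\<rbrakk> \<Longrightarrow> Add C (iA \<odot> (pA \<odot> h)) (iB \<odot> (pB \<odot> h)) = h"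
proof -
  note [simp] = is_biproduct_arrows[OF bip]
  show e: "pA \<odot> iA = Idn C A" "pB \<odot> iB = Idn C B" "pA \<odot> iB = Zro C B A" "pB \<odot> iA = Zro C A B"
    "Add C (iA \<odot> pA) (iB \<odot> pB) = Idn C S"
    using bip by (auto simp: is_biproduct_def)
  show "pA \<odot> (iA \<odot> h) = h" if "h \<in> Ar C" "Cod C h = A"
    using that Cmp_reassoc[OF e(1), of h] by simp
  show "pB \<odot> (iB \<odot> h) = h" if "h \<in> Ar C" "Cod C h = B"
    using that Cmp_reassoc[OF e(2), of h] by simp
  show "pA \<odot> (iB \<odot> h) = Zro C (Dom C h) A" if "h \<in> Ar C" "Cod C h = B"
    using that Cmp_reassoc[OF e(3), of h] by simp
  show "pB \<odot> (iA \<odot> h) = Zro C (Dom C h) B" if "h \<in> Ar C" "Cod C h = A"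
    using that Cmp_reassoc[OF e(4), of h] by simp
  show "Add C (iA \<odot> (pA \<odot> h)) (iB \<odot> (pB \<odot> h)) = h" if "h \<in> Ar C" "Cod C h = S"
    using that Add_Cmp_arrow[of h "iA \<odot> pA" "iB \<odot> pB"] by (simp add: e(5))
qed

lemma is_biproduct_swap:
  assumes bip: "is_biproduct C A B S iA iB pA pB"
  shows "is_biproduct C B A S iB iA pB pA"
proof -
  note [simp] = is_biproduct_arrows[OF bip] is_biproduct_Cmp[OF bip]
  have "Add C (iB \<odot> pB) (iA \<odot> pA) = Idn C S"
    using Add_commute[of "iB \<odot> pB" "iA \<odot> pA"] by simp
  then show ?thesis by (simp add: is_biproduct_def Mor_iff)
qed

text \<open>Only the left summand is transported; the right one is reached through
  \<open>is_biproduct_swap\<close>.\<close>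

lemma is_biproduct_iso_left:
  assumes bip: "is_biproduct C A B S iA iB pA pB" and "isomorphic C A A'"
  shows "\<exists>iA' pA'. is_biproduct C A' B S iA' iB pA' pB"
proof -
  note [simp] = is_biproduct_arrows[OF bip] is_biproduct_Cmp[OF bip]
  obtain a a' where a: "a \<in> Mor C A A'" "a' \<in> Mor C A' A" "a' \<odot> a = Idn C A" "a \<odot> a' = Idn C A'"
    using assms(2) by (rule isomorphicE)
  then have [simp]: "a \<in> Ar C" "Dom C a = A" "Cod C a = A'" "a' \<in> Ar C" "Dom C a' = A'" "Cod C a' = A"
    by (auto simp: Mor_iff)
  have [simp]: "A' \<in> Ob C" using Dom_in_Ob[of a'] by simp
  have "a' \<odot> (a \<odot> pA) = pA" using Cmp_reassoc[OF a(3), of pA] by simp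
  then have "is_biproduct C A' B S (iA \<odot> a') iB (a \<odot> pA) pB"
    using a(3,4) by (simp add: is_biproduct_def Mor_iff)
  then show ?thesis by blast
qed

lemma is_biproduct_iso_sum:
  assumes bip: "is_biproduct C A B S iA iB pA pB" and "isomorphic C S S'"
  shows "\<exists>iA' iB' pA' pB'. is_biproduct C A B S' iA' iB' pA' pB'"
proof -
  note [simp] = is_biproduct_arrows[OF bip] is_biproduct_Cmp[OF bip]
  obtain s s' where s: "s \<in> Mor C S S'" "s' \<in> Mor C S' S" "s' \<odot> s = Idn C S" "s \<odot> s' = Idn C S'"
    using assms(2) by (rule isomorphicE)
  then have [simp]: "s \<in> Ar C" "Dom C s = S" "Cod C s = S'" "s' \<in> Ar C" "Dom C s' = S'" "Cod C s' = S"
    by (auto simp: Mor_iff)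
  have [simp]: "S' \<in> Ob C" using Dom_in_Ob[of s'] by simp
  have [simp]: "s' \<odot> (s \<odot> iA) = iA" "s' \<odot> (s \<odot> iB) = iB"
    using Cmp_reassoc[OF s(3), of iA] Cmp_reassoc[OF s(3), of iB] by simp_all
  \<comment> \<open>Factor out \<open>s\<close> on the left: what remains is the identity
    decomposition of \<open>S\<close> applied to \<open>s'\<close>.\<close>
  have "Add C (s \<odot> (iA \<odot> (pA \<odot> s'))) (s \<odot> (iB \<odot> (pB \<odot> s'))) = s \<odot> s'"
    using Cmp_Add_arrow[of "iA \<odot> (pA \<odot> s')" "iB \<odot> (pB \<odot> s')" s] by (simp del: Cmp_Add_arrow)
  then have "is_biproduct C A B S' (s \<odot> iA) (s \<odot> iB) (pA \<odot> s') (pB \<odot> s')"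
    using s(3,4) by (simp add: is_biproduct_def Mor_iff)
  then show ?thesis by blast
qed

lemma is_biproduct_unique:
  assumes bip: "is_biproduct C A B S iA iB pA pB" and bip': "is_biproduct C A B S' iA' iB' pA' pB'"
  shows "isomorphic C S S'"
proof -
  note [simp] = is_biproduct_arrows[OF bip] is_biproduct_arrows[OF bip']
    is_biproduct_Cmp[OF bip] is_biproduct_Cmp[OF bip']
  show ?thesis
    \<comment> \<open>The arrows that match the summands of \<open>S\<close> with those of
      \<open>S'\<close> and back.\<close>
    by (rule isomorphicI[of "Add C (iA' \<odot> pA) (iB' \<odot> pB)" _ _ "Add C (iA \<odot> pA') (iB \<odot> pB')"])
      (simp_all add: Mor_iff)
qed

lemma in_Iso_mult_iff:
  "S \<in> x \<otimes>\<^bsub>Iso C\<^esub> y \<longleftrightarrow> (\<exists>A \<in> x. \<exists>B \<in> y. \<exists>iA iB pA pB. is_biproduct C A B S iA iB pA pB)"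
  by (simp add: Iso_def)

text \<open>A biproduct of other representatives is transported to one of \<open>A\<close> and
  \<open>B\<close>, where uniqueness applies; conversely the structure maps carry over to any object
  isomorphic to \<open>S\<close>. So the set-valued product is a single class.\<close>

lemma Iso_mult_isoclass:
  assumes bip: "is_biproduct C A B S iA iB pA pB"
  shows "isoclass C A \<otimes>\<^bsub>Iso C\<^esub> isoclass C B = isoclass C S"
proof -
  have "S' \<in> isoclass C S"
    if AB: "A' \<in> isoclass C A" "B' \<in> isoclass C B"
      and bip': "is_biproduct C A' B' S' iA' iB' pA' pB'" for A' B' S' iA' iB' pA' pB'
  proof -
    have "isomorphic C A' A" "isomorphic C B' B"
      using AB by (auto simp: isoclass_def intro: isomorphic_sym)
    obtain iA2 pA2 where "is_biproduct C A B' S' iA2 iB' pA2 pB'"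
      using is_biproduct_iso_left[OF bip' \<open>isomorphic C A' A\<close>] by auto
    from is_biproduct_iso_left[OF is_biproduct_swap[OF this] \<open>isomorphic C B' B\<close>]
    obtain iB2 pB2 where "is_biproduct C B A S' iB2 iA2 pB2 pA2" by auto
    from is_biproduct_unique[OF bip is_biproduct_swap[OF this]]
    show ?thesis using isomorphic_Ob by (auto simp: isoclass_def)
  qed
  moreover have "\<exists>iA iB pA pB. is_biproduct C A B S' iA iB pA pB" if "S' \<in> isoclass C S" for S'
    using is_biproduct_iso_sum[OF bip] that by (auto simp: isoclass_def)
  ultimately show ?thesis
    using self_in_isoclass[of A] self_in_isoclass[of B] is_biproduct_arrows(1,2)[OF bip]
    by (intro Set.set_eqI iffI) (simp_all only: in_Iso_mult_iff, blast, metis)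
qed

lemma Iso_mult_commute: "x \<otimes>\<^bsub>Iso C\<^esub> y = y \<otimes>\<^bsub>Iso C\<^esub> x"
proof -
  have "S \<in> v \<otimes>\<^bsub>Iso C\<^esub> u" if S: "S \<in> u \<otimes>\<^bsub>Iso C\<^esub> v" for S u v
  proof -
    obtain A B iA iB pA pB where "A \<in> u" "B \<in> v" and bip: "is_biproduct C A B S iA iB pA pB"
      using S unfolding in_Iso_mult_iff by (elim bexE exE)
    then show ?thesis
      unfolding in_Iso_mult_iff by (intro bexI exI) (rule is_biproduct_swap[OF bip])
  qed
  then show ?thesis by blast
qed

lemma is_biproduct_zero:
  assumes "X \<in> Ob C" "is_zero_object C Z"
  shows "is_biproduct C X Z X (Idn C X) (Zro C Z X) (Idn C X) (Zro C X Z)"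
  using assms by (auto simp: is_biproduct_def Mor_iff is_zero_object_iff)

end

section \<open>Exact categories\<close>

context exact_category
begin

lemma Ses_arrows:
  assumes "(i, j) \<in> Ses C"
  shows "i \<in> Ar C" "j \<in> Ar C" "Dom C j = Cod C i" "j \<odot> i = Zro C (Dom C i) (Cod C j)"
  using Ses_kernel[OF assms] by (auto simp: is_kernel_def)

lemma Seqs_iff: "(i, j) \<in> Seqs C A B X \<longleftrightarrow> (i, j) \<in> Ses C \<and> Dom C i = B \<and> Cod C i = X \<and> Cod C j = A"
  by (auto simp: Seqs_def Mor_iff Ses_arrows)

text \<open>Both \<open>u\<close> and \<open>v\<close> factor \<open>i \<odot> u\<close> through the
  kernel \<open>i\<close>, and such a factorization is unique.\<close>

lemma Ses_mono_cancel:
  assumes "(i, j) \<in> Ses C" "u \<in> Mor C T (Dom C i)" "v \<in> Mor C T (Dom C i)" "i \<odot> u = i \<odot> v"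
  shows "u = v"
proof -
  note [simp] = Ses_arrows[OF assms(1)]
  have u: "u \<in> Ar C" "Dom C u = T" "Cod C u = Dom C i" using assms(2) by (auto simp: Mor_iff)
  then have T: "T \<in> Ob C" "Cod C j \<in> Ob C" "Cod C i \<in> Ob C" "Dom C i \<in> Ob C"
    by (auto intro: Dom_in_Ob Cod_in_Ob)
  have "j \<odot> (i \<odot> u) = Zro C T (Cod C j)" using u T Cmp_reassoc[OF Ses_arrows(4)[OF assms(1)], of u] by simp
  then have "\<exists>!w. w \<in> Mor C T (Dom C i) \<and> i \<odot> w = i \<odot> u"
    using Ses_kernel[OF assms(1)] u T by (auto simp: is_kernel_def Mor_iff)
  then show ?thesis using assms by metis
qed

lemma Ses_epi_cancel:
  assumes "(i, j) \<in> Ses C" "u \<in> Mor C (Cod C j) T" "v \<in> Mor C (Cod C j) T" "u \<odot> j = v \<odot> j"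
  shows "u = v"
proof -
  note [simp] = Ses_arrows[OF assms(1)]
  have u: "u \<in> Ar C" "Cod C u = T" "Dom C u = Cod C j" using assms(2) by (auto simp: Mor_iff)
  then have T: "T \<in> Ob C" "Cod C j \<in> Ob C" "Cod C i \<in> Ob C" "Dom C i \<in> Ob C"
    by (auto intro: Dom_in_Ob Cod_in_Ob)
  have "(u \<odot> j) \<odot> i = Zro C (Dom C i) T" using u T by simp
  then have "\<exists>!w. w \<in> Mor C (Cod C j) T \<and> w \<odot> j = u \<odot> j"
    using Ses_cokernel[OF assms(1)] u T by (auto simp: is_cokernel_def Mor_iff)
  then show ?thesis using assms by metis
qed

section \<open>Short exact sequences with a zero term\<close>

text \<open>Here \<open>j\<close> is zero, so the identity of the middle object factors through the
  kernel \<open>i\<close>. This gives a right inverse of \<open>i\<close>, which is two-sided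
  because \<open>i\<close> is left cancellable.\<close>

lemma Ses_zero_right_is_iso:
  assumes "(i, j) \<in> Ses C" "is_zero_object C (Cod C j)"
  shows "is_iso C i"
proof -
  note [simp] = Ses_arrows[OF assms(1)]
  have [simp]: "Cod C i \<in> Ob C" "Dom C i \<in> Ob C" by (auto intro: Dom_in_Ob Cod_in_Ob)
  have z: "j = Zro C (Cod C i) (Cod C j)"
    using assms(2) by (rule Mor_to_zero_object) (simp add: Mor_iff)
  have "j \<odot> Idn C (Cod C i) = Zro C (Cod C i) (Cod C j)" by (simp flip: z)
  then obtain w where w: "w \<in> Mor C (Cod C i) (Dom C i)" "i \<odot> w = Idn C (Cod C i)"
    using Ses_kernel[OF assms(1)] unfolding is_kernel_def
    by (metis Idn_in_Mor \<open>Cod C i \<in> Ob C\<close>)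
  then have [simp]: "w \<in> Ar C" "Dom C w = Cod C i" "Cod C w = Dom C i" by (auto simp: Mor_iff)
  have "w \<odot> i = Idn C (Dom C i)"
    by (rule Ses_mono_cancel[OF assms(1)]) (use Cmp_reassoc[OF w(2), of i] in \<open>auto simp: Mor_iff\<close>)
  then show ?thesis using w by (intro is_isoI[of i "Dom C i" "Cod C i" w]) (auto simp: Mor_iff)
qed

text \<open>Dual argument: \<open>i\<close> is zero, so the identity of the middle object factors
  through the cokernel \<open>j\<close>.\<close>

lemma Ses_zero_left_is_iso:
  assumes "(i, j) \<in> Ses C" "is_zero_object C (Dom C i)"
  shows "is_iso C j"
proof -
  note [simp] = Ses_arrows[OF assms(1)]
  have [simp]: "Cod C i \<in> Ob C" "Cod C j \<in> Ob C" by (auto intro: Dom_in_Ob Cod_in_Ob)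
  have z: "i = Zro C (Dom C i) (Cod C i)"
    using assms(2) by (rule Mor_from_zero_object) (simp add: Mor_iff)
  have "Idn C (Cod C i) \<odot> i = Zro C (Dom C i) (Cod C i)" by (simp flip: z)
  then obtain w where w: "w \<in> Mor C (Cod C j) (Cod C i)" "w \<odot> j = Idn C (Cod C i)"
    using Ses_cokernel[OF assms(1)] unfolding is_cokernel_def
    by (metis Idn_in_Mor \<open>Cod C i \<in> Ob C\<close>)
  then have [simp]: "w \<in> Ar C" "Dom C w = Cod C j" "Cod C w = Cod C i" by (auto simp: Mor_iff)
  have "j \<odot> w = Idn C (Cod C j)"
    by (rule Ses_epi_cancel[OF assms(1), where T = "Cod C j"]) (use w(2) in \<open>auto simp: Mor_iff\<close>)
  then show ?thesis using w by (intro is_isoI[of j "Cod C i" "Cod C j" w]) (auto simp: Mor_iff)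
qed

text \<open>Both arrows are zero, so composing them with an identity or with a zero arrow gives the
  same result; cancelling \<open>i\<close> or \<open>j\<close> identifies the identity with
  zero.\<close>

lemma Ses_zero_middle:
  assumes "(i, j) \<in> Ses C" "is_zero_object C (Cod C i)"
  shows "is_zero_object C (Dom C i)" "is_zero_object C (Cod C j)"
proof -
  note [simp] = Ses_arrows[OF assms(1)]
  have [simp]: "Cod C i \<in> Ob C" "Dom C i \<in> Ob C" "Cod C j \<in> Ob C" by (auto intro: Dom_in_Ob Cod_in_Ob)
  have z: "i = Zro C (Dom C i) (Cod C i)"
    using assms(2) by (rule Mor_to_zero_object) (simp add: Mor_iff)
  have "i \<odot> Idn C (Dom C i) = i \<odot> Zro C (Dom C i) (Dom C i)" by (simp flip: z)
  then have "Idn C (Dom C i) = Zro C (Dom C i) (Dom C i)"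
    by (rule Ses_mono_cancel[OF assms(1), rotated 2]) (simp_all add: Mor_iff)
  then show "is_zero_object C (Dom C i)" by (simp add: is_zero_object_iff)
  have z: "j = Zro C (Cod C i) (Cod C j)"
    using assms(2) by (rule Mor_from_zero_object) (simp add: Mor_iff)
  have "Idn C (Cod C j) \<odot> j = Zro C (Cod C j) (Cod C j) \<odot> j" by (simp flip: z)
  then have "Idn C (Cod C j) = Zro C (Cod C j) (Cod C j)"
    by (rule Ses_epi_cancel[OF assms(1), rotated 2]) (simp_all add: Mor_iff)
  then show "is_zero_object C (Cod C j)" by (simp add: is_zero_object_iff)
qed

section \<open>Adding an object to a short exact sequence\<close>

text \<open>Being an admissible monomorphism only provides some cokernel. Cokernels are unique up to
  isomorphism and the sequences are closed under isomorphism, so any prescribed cokernel may be used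
  instead.\<close>

lemma Ses_of_cokernel:
  assumes ses: "(i, j) \<in> Ses C" and j': "is_cokernel C j' i"
  shows "(i, j') \<in> Ses C"
proof -
  note [simp] = Ses_arrows[OF ses]
  have j'_arrow [simp]: "j' \<in> Ar C" "Dom C j' = Cod C i" "j' \<odot> i = Zro C (Dom C i) (Cod C j')"
    and j'_ex1: "\<And>T u. \<lbrakk>T \<in> Ob C; u \<in> Mor C (Cod C i) T; u \<odot> i = Zro C (Dom C i) T\<rbrakk> \<Longrightarrow>
      \<exists>!w. w \<in> Mor C (Cod C j') T \<and> w \<odot> j' = u"
    using j' by (auto simp: is_cokernel_def)
  have j_ex1: "\<And>T u. \<lbrakk>T \<in> Ob C; u \<in> Mor C (Cod C i) T; u \<odot> i = Zro C (Dom C i) T\<rbrakk> \<Longrightarrow>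
      \<exists>!w. w \<in> Mor C (Cod C j) T \<and> w \<odot> j = u"
    using Ses_cokernel[OF ses] by (auto simp: is_cokernel_def)
  have Ob [simp]: "Cod C i \<in> Ob C" "Dom C i \<in> Ob C" "Cod C j \<in> Ob C" "Cod C j' \<in> Ob C"
    by (auto intro: Dom_in_Ob Cod_in_Ob)
  obtain a where a: "a \<in> Mor C (Cod C j) (Cod C j')" "a \<odot> j = j'"
    using j_ex1[of "Cod C j'" j'] by (auto simp: Mor_iff)
  obtain b where b: "b \<in> Mor C (Cod C j') (Cod C j)" "b \<odot> j' = j"
    using j'_ex1[of "Cod C j" j] by (auto simp: Mor_iff)
  have [simp]: "a \<in> Ar C" "Dom C a = Cod C j" "Cod C a = Cod C j'"
    "b \<in> Ar C" "Dom C b = Cod C j'" "Cod C b = Cod C j"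
    using a b by (auto simp: Mor_iff)
  have "b \<odot> a = Idn C (Cod C j)"
    by (rule Ses_epi_cancel[OF ses, of _ "Cod C j"]) (simp_all add: Mor_iff a b)
  \<comment> \<open>\<open>j'\<close> is not yet known to occur in a sequence, so uniqueness comes
    from its own universal property.\<close>
  moreover have "a \<odot> b = Idn C (Cod C j')"
  proof -
    have "\<exists>!w. w \<in> Mor C (Cod C j') (Cod C j') \<and> w \<odot> j' = j'"
      using j'_ex1[of "Cod C j'" j'] by (simp add: Mor_iff)
    moreover have "a \<odot> b \<in> Mor C (Cod C j') (Cod C j')" "(a \<odot> b) \<odot> j' = j'"
      "Idn C (Cod C j') \<in> Mor C (Cod C j') (Cod C j')" "Idn C (Cod C j') \<odot> j' = j'"
      by (simp_all add: Mor_iff a b)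
    ultimately show ?thesis by blast
  qed
  ultimately have "is_iso C a"
    using a b by (intro is_isoI)
  then show ?thesis
    by (intro Ses_iso[OF ses, where b = "Idn C (Dom C i)" and x = "Idn C (Cod C i)" and a = a])
      (simp_all add: Mor_iff a is_iso_Idn)
qed

text \<open>The admissible monomorphism of the sum is a composite of \<open>i\<close> with a split monomorphism, so it
  only remains to identify its cokernel.\<close>

lemma Ses_biproduct:
  assumes ses: "(i, j) \<in> Ses C"
    and S: "is_biproduct C (Cod C i) Y S iX iY pX pY"
    and P: "is_biproduct C (Cod C j) Y P kM kY qM qY"
  shows "(iX \<odot> i, Add C (kM \<odot> (j \<odot> pX)) (kY \<odot> pY)) \<in> Ses C"
proof -
  note [simp] = Ses_arrows[OF ses] is_biproduct_arrows[OF S] is_biproduct_Cmp[OF S]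
    is_biproduct_arrows[OF P] is_biproduct_Cmp[OF P]
  have [simp]: "Dom C i \<in> Ob C" by (simp add: Dom_in_Ob)
  \<comment> \<open>The direct sum of \<open>j\<close> and the identity of \<open>Y\<close>, written
    in biproduct coordinates.\<close>
  define J where "J = Add C (kM \<odot> (j \<odot> pX)) (kY \<odot> pY)"
  have [simp]: "J \<in> Ar C" "Dom C J = S" "Cod C J = P" by (simp_all add: J_def)
  have J: "J \<odot> iX = kM \<odot> j" "J \<odot> iY = kY" by (simp_all add: J_def)
  have "J \<odot> (iX \<odot> i) = Zro C (Dom C i) P"
    by (simp add: J_def)
  moreover have "\<exists>!w. w \<in> Mor C P T \<and> w \<odot> J = u"
    if T: "T \<in> Ob C" "u \<in> Mor C S T" "u \<odot> (iX \<odot> i) = Zro C (Dom C i) T" for T u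
  proof -
    have [simp]: "T \<in> Ob C" "u \<in> Ar C" "Dom C u = S" "Cod C u = T"
      using T by (auto simp: Mor_iff)
    have "\<exists>!w. w \<in> Mor C (Cod C j) T \<and> w \<odot> j = u \<odot> iX"
      using Ses_cokernel[OF ses] T(3) by (auto simp: is_cokernel_def Mor_iff)
    then obtain w where w: "w \<in> Mor C (Cod C j) T" "w \<odot> j = u \<odot> iX" by blast
    then have [simp]: "w \<in> Ar C" "Dom C w = Cod C j" "Cod C w = T" by (auto simp: Mor_iff)
    \<comment> \<open>The factorization of \<open>u\<close> is assembled by summands: on
      \<open>Cod C j\<close> it is the arrow \<open>w\<close> induced by
      \<open>u \<odot> iX\<close>, on \<open>Y\<close> it is \<open>u\<close> itself.\<close>
    define v where "v = Add C (w \<odot> qM) (u \<odot> (iY \<odot> qY))"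
    have v: "v \<in> Mor C P T" by (simp add: v_def Mor_iff)
    have "v \<odot> J = Add C (w \<odot> (j \<odot> pX)) (u \<odot> (iY \<odot> pY))"
      by (simp add: v_def J_def)
    also have "w \<odot> (j \<odot> pX) = u \<odot> (iX \<odot> pX)"
      using Cmp_reassoc[OF w(2), of pX] by simp
    also have "Add C (u \<odot> (iX \<odot> pX)) (u \<odot> (iY \<odot> pY)) = u"
      using Cmp_Add_arrow[of "iX \<odot> pX" "iY \<odot> pY" u] by (simp del: Cmp_Add_arrow)
    finally have "v \<odot> J = u" .
    moreover have "x = y" if xy: "x \<in> Mor C P T" "y \<in> Mor C P T" "x \<odot> J = y \<odot> J" for x y
    proof -
      have [simp]: "x \<in> Ar C" "Dom C x = P" "Cod C x = T" "y \<in> Ar C" "Dom C y = P" "Cod C y = T"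
        using xy by (auto simp: Mor_iff)
      have eq: "x \<odot> (J \<odot> h) = y \<odot> (J \<odot> h)" if "h \<in> Ar C" "Cod C h = S" for h
        using Cmp_reassoc[OF xy(3), of h] that by simp
      \<comment> \<open>Uniqueness is tested on the two summands of \<open>P\<close>: on the first
        \<open>j\<close> can be cancelled, on the second \<open>J\<close> is just
        \<open>kY\<close>.\<close>
      have e: "x \<odot> (kM \<odot> j) = y \<odot> (kM \<odot> j)" using eq[of iX] by (simp add: J)
      have "x \<odot> kM = y \<odot> kM"
        by (rule Ses_epi_cancel[OF ses, of _ T]) (simp_all add: Mor_iff e)
      moreover have "x \<odot> kY = y \<odot> kY" using eq[of iY] by (simp add: J)
      moreover have "z = Add C ((z \<odot> kM) \<odot> qM) ((z \<odot> kY) \<odot> qY)"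
        if "z \<in> Ar C" "Dom C z = P" for z
        using that Cmp_Add_arrow[of "kM \<odot> qM" "kY \<odot> qY" z] by (simp del: Cmp_Add_arrow)
      ultimately show "x = y" by (metis xy(1,2) Mor_iff)
    qed
    ultimately show ?thesis using v by blast
  qed
  ultimately have coker: "is_cokernel C J (iX \<odot> i)"
    by (auto simp: is_cokernel_def)
  have "adm_mono C iX" using Ses_split[OF S] by (auto simp: adm_mono_def)
  then have "adm_mono C (iX \<odot> i)"
    using ses by (intro adm_mono_Cmp) (auto simp: adm_mono_def)
  then show ?thesis
    using Ses_of_cokernel coker by (auto simp: adm_mono_def J_def)
qed

section \<open>Elementary properties of the sets of extensions\<close>

lemma Ext1_iff: "x \<in> Ext1 C A B \<longleftrightarrow>
    (\<exists>i j. (i, j) \<in> Ses C \<and> Dom C i = B \<and> Cod C j = A \<and> x = isoclass C (Cod C i))"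
proof
  assume "x \<in> Ext1 C A B"
  then obtain X i j where "x = isoclass C X" "(i, j) \<in> Seqs C A B X"
    by (auto simp: Ext1_def)
  then show "\<exists>i j. (i, j) \<in> Ses C \<and> Dom C i = B \<and> Cod C j = A \<and> x = isoclass C (Cod C i)"
    unfolding Seqs_iff by blast
next
  assume "\<exists>i j. (i, j) \<in> Ses C \<and> Dom C i = B \<and> Cod C j = A \<and> x = isoclass C (Cod C i)"
  then obtain i j where ij: "(i, j) \<in> Ses C" "Dom C i = B" "Cod C j = A" "x = isoclass C (Cod C i)"
    by blast
  then have "(i, j) \<in> Seqs C A B (Cod C i)" by (simp add: Seqs_iff)
  moreover have "Cod C i \<in> Ob C" using Ses_arrows(1)[OF ij(1)] by (rule Cod_in_Ob)
  ultimately show "x \<in> Ext1 C A B" using ij(4) unfolding Ext1_def by blast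
qed

lemma biproduct_in_Ext1:
  assumes "is_biproduct C A B S iA iB pA pB"
  shows "isoclass C S \<in> Ext1 C A B"
  \<comment> \<open>\<open>Ses_split\<close> makes the first summand the subobject, while in
    \<open>Ext1 C A B\<close> the subobject is \<open>B\<close>; hence the swap.\<close>
  using Ses_split[OF is_biproduct_swap[OF assms]] is_biproduct_arrows[OF assms]
  by (force simp: Ext1_iff)

lemma Ext1_zero_right:
  assumes "x \<in> Ext1 C A B" "is_zero_object C B"
  shows "x = isoclass C A"
proof -
  obtain i j where ij: "(i, j) \<in> Ses C" "Dom C i = B" "Cod C j = A" "x = isoclass C (Cod C i)"
    using assms by (auto simp: Ext1_iff)
  note [simp] = Ses_arrows[OF ij(1)]
  have "isomorphic C (Cod C i) A"
    using Ses_zero_left_is_iso[OF ij(1)] assms(2) ij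
    by (auto simp: isomorphic_def Mor_iff intro!: bexI[of _ j])
  then show ?thesis using ij isomorphic_Ob isoclass_eq_iff by blast
qed

lemma Ext1_zero_left:
  assumes "x \<in> Ext1 C A B" "is_zero_object C A"
  shows "x = isoclass C B"
proof -
  obtain i j where ij: "(i, j) \<in> Ses C" "Dom C i = B" "Cod C j = A" "x = isoclass C (Cod C i)"
    using assms by (auto simp: Ext1_iff)
  note [simp] = Ses_arrows[OF ij(1)]
  have "isomorphic C B (Cod C i)"
    using Ses_zero_right_is_iso[OF ij(1)] assms(2) ij
    by (auto simp: isomorphic_def Mor_iff intro!: bexI[of _ i])
  then show ?thesis using ij isomorphic_Ob isoclass_eq_iff by blast
qed

lemma zero_class_in_Ext1:
  assumes "zero_class C \<in> Ext1 C A B"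
  shows "is_zero_object C A" "is_zero_object C B"
proof -
  obtain i j where ij: "(i, j) \<in> Ses C" "Dom C i = B" "Cod C j = A" "zero_class C = isoclass C (Cod C i)"
    using assms by (auto simp: Ext1_iff)
  then have "is_zero_object C (Cod C i)"
    using isoclass_eq_zero_class_iff Cod_in_Ob Ses_arrows(1) by metis
  then show "is_zero_object C A" "is_zero_object C B"
    using Ses_zero_middle[OF ij(1)] ij by auto
qed

end

section \<open>The Grothendieck monoid\<close>

text \<open>The one-step relation is named so that properties of the congruence reduce to single
  steps, by induction on its transitive closure.\<close>

definition Ext1_rel :: "('o, 'm, 'r) excat_scheme \<Rightarrow> 'o set rel" where
  "Ext1_rel C = {(x, y). \<exists>M \<in> Ob C. \<exists>N \<in> Ob C. x \<in> Ext1 C M N \<and> y \<in> Ext1 C M N}"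

lemma Groth_cong_eq: "Groth_cong C = (Ext1_rel C)\<^sup>+"
  by (simp add: Groth_cong_def Ext1_rel_def)

context exact_category
begin

lemma carrier_Iso: "carrier (Iso C) = isoclass C ` Ob C"
  by (simp add: Iso_def)

lemma one_Iso: "\<one>\<^bsub>Iso C\<^esub> = zero_class C"
  by (simp add: Iso_def)

lemma Ext1_in_Iso: "x \<in> Ext1 C A B \<Longrightarrow> x \<in> carrier (Iso C)"
  by (auto simp: Ext1_def carrier_Iso)

lemma isoclass_in_Ext1:
  assumes "X \<in> Ob C" "is_zero_object C Z"
  shows "isoclass C X \<in> Ext1 C X Z" "isoclass C X \<in> Ext1 C Z X"
  using biproduct_in_Ext1[OF is_biproduct_zero[OF assms]]
    biproduct_in_Ext1[OF is_biproduct_swap[OF is_biproduct_zero[OF assms]]] .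

text \<open>\<open>X\<close> is a split extension of itself by a zero object. This makes the
  transitive closure reflexive without adding the diagonal.\<close>

lemma Ext1_rel_refl: "x \<in> carrier (Iso C) \<Longrightarrow> (x, x) \<in> Ext1_rel C"
proof -
  assume "x \<in> carrier (Iso C)"
  then obtain X where "X \<in> Ob C" "x = isoclass C X" by (auto simp: carrier_Iso)
  moreover obtain Z where "is_zero_object C Z" using ex_zero_object by blast
  moreover from this have "Z \<in> Ob C" by (simp add: is_zero_object_def)
  ultimately show ?thesis using isoclass_in_Ext1(1) unfolding Ext1_rel_def by blast
qed

lemma equiv_Groth_cong: "equiv (carrier (Iso C)) (Groth_cong C)"
proof (rule equivI)
  have "Ext1_rel C \<subseteq> carrier (Iso C) \<times> carrier (Iso C)"
    by (auto simp: Ext1_rel_def Ext1_in_Iso)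
  then show sub: "Groth_cong C \<subseteq> carrier (Iso C) \<times> carrier (Iso C)"
    unfolding Groth_cong_eq by (rule trancl_subset_Sigma)
  show "refl_on (carrier (Iso C)) (Groth_cong C)"
    using Ext1_rel_refl by (auto simp: refl_on_def Groth_cong_eq)
  show "sym (Groth_cong C)"
    unfolding Groth_cong_eq by (rule sym_trancl) (auto simp: sym_def Ext1_rel_def)
  show "trans (Groth_cong C)"
    unfolding Groth_cong_eq by (rule trans_trancl)
qed

lemma self_in_Groth_class: "x \<in> carrier (Iso C) \<Longrightarrow> x \<in> Groth_class C x"
  unfolding Groth_class_def using equiv_Groth_cong by (rule equiv_class_self)

lemma carrier_Groth: "carrier (Groth C) = Groth_class C ` carrier (Iso C)"
  by (auto simp: Groth_def quotient_def Groth_class_def)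

lemma one_Groth: "\<one>\<^bsub>Groth C\<^esub> = Groth_class C (zero_class C)"
  by (simp add: Groth_def one_Iso)

section \<open>Compatibility of the congruence with sums\<close>

text \<open>Adding \<open>Y\<close> to the middle and the quotient of a sequence keeps it exact. The
  new ends \<open>P\<close> and \<open>N\<close> do not depend on \<open>x\<close>, so two classes
  in a common extension set stay in a common one.\<close>

lemma Ext1_mult:
  assumes "x \<in> Ext1 C M N" and P: "is_biproduct C M Y P kM kY qM qY"
  shows "x \<otimes>\<^bsub>Iso C\<^esub> isoclass C Y \<in> Ext1 C P N"
proof -
  obtain i j where ij: "(i, j) \<in> Ses C" "Dom C i = N" "Cod C j = M" "x = isoclass C (Cod C i)"
    using assms by (auto simp: Ext1_iff)
  note [simp] = Ses_arrows[OF ij(1)] is_biproduct_arrows[OF P]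
  have "Cod C i \<in> Ob C" by (simp add: Cod_in_Ob)
  then obtain S iX iY pX pY where S: "is_biproduct C (Cod C i) Y S iX iY pX pY"
    using ex_biproduct[of "Cod C i" Y] by auto
  note [simp] = is_biproduct_arrows[OF S]
  have "(iX \<odot> i, Add C (kM \<odot> (j \<odot> pX)) (kY \<odot> pY)) \<in> Ses C"
    using Ses_biproduct[OF ij(1) S] P ij(3) by blast
  moreover have "Dom C (iX \<odot> i) = N" "Cod C (iX \<odot> i) = S"
    "Cod C (Add C (kM \<odot> (j \<odot> pX)) (kY \<odot> pY)) = P"
    using ij by simp_all
  ultimately show ?thesis
    unfolding Ext1_iff ij(4) Iso_mult_isoclass[OF S] by metis
qed

lemma Ext1_rel_mult:
  assumes "(x, x') \<in> Ext1_rel C" "y \<in> carrier (Iso C)"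
  shows "(x \<otimes>\<^bsub>Iso C\<^esub> y, x' \<otimes>\<^bsub>Iso C\<^esub> y) \<in> Ext1_rel C"
proof -
  obtain M N where MN: "M \<in> Ob C" "N \<in> Ob C" "x \<in> Ext1 C M N" "x' \<in> Ext1 C M N"
    using assms by (auto simp: Ext1_rel_def)
  obtain Y where Y: "Y \<in> Ob C" "y = isoclass C Y" using assms by (auto simp: carrier_Iso)
  obtain P kM kY qM qY where P: "is_biproduct C M Y P kM kY qM qY"
    using ex_biproduct MN(1) Y(1) by metis
  show ?thesis
    using Ext1_mult[OF _ P] MN Y is_biproduct_arrows(3)[OF P] unfolding Ext1_rel_def by blast
qed

lemma Groth_cong_mult_left:
  assumes "(x, x') \<in> Groth_cong C" "y \<in> carrier (Iso C)"
  shows "(x \<otimes>\<^bsub>Iso C\<^esub> y, x' \<otimes>\<^bsub>Iso C\<^esub> y) \<in> Groth_cong C"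
  using assms(1) unfolding Groth_cong_eq
proof (induction rule: trancl_induct)
  case (base z)
  then show ?case using Ext1_rel_mult assms(2) by blast
next
  case (step z z')
  then show ?case using Ext1_rel_mult[OF step(2) assms(2)] by (intro trancl_into_trancl[OF step(3)])
qed

text \<open>Replace one summand at a time, using commutativity for the second, and compose the two
  relations.\<close>

lemma Groth_cong_mult:
  assumes "(x, x') \<in> Groth_cong C" "(y, y') \<in> Groth_cong C"
  shows "(x \<otimes>\<^bsub>Iso C\<^esub> y, x' \<otimes>\<^bsub>Iso C\<^esub> y') \<in> Groth_cong C"
proof -
  have "x' \<in> carrier (Iso C)" "y \<in> carrier (Iso C)"
    using assms equiv_Groth_cong by (auto simp: equiv_def)
  then have "(x \<otimes>\<^bsub>Iso C\<^esub> y, x' \<otimes>\<^bsub>Iso C\<^esub> y) \<in> Groth_cong C"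
    "(y \<otimes>\<^bsub>Iso C\<^esub> x', y' \<otimes>\<^bsub>Iso C\<^esub> x') \<in> Groth_cong C"
    using assms by (auto intro: Groth_cong_mult_left)
  then show ?thesis
    using equiv_Groth_cong by (metis Iso_mult_commute equivE transE)
qed

lemma Groth_class_mult:
  assumes "x \<in> carrier (Iso C)" "y \<in> carrier (Iso C)"
  shows "Groth_class C x \<otimes>\<^bsub>Groth C\<^esub> Groth_class C y = Groth_class C (x \<otimes>\<^bsub>Iso C\<^esub> y)"
proof -
  have "Groth_class C (x' \<otimes>\<^bsub>Iso C\<^esub> y') = Groth_class C (x \<otimes>\<^bsub>Iso C\<^esub> y)"
    if "x' \<in> Groth_class C x" "y' \<in> Groth_class C y" for x' y'
  proof -
    have "(x \<otimes>\<^bsub>Iso C\<^esub> y, x' \<otimes>\<^bsub>Iso C\<^esub> y') \<in> Groth_cong C"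
      using that Groth_cong_mult by (auto simp: Groth_class_def)
    then show ?thesis
      unfolding Groth_class_def by (metis equiv_Groth_cong equiv_class_eq)
  qed
  \<comment> \<open>A union of equal sets is their common value only over a nonempty index
    set.\<close>
  moreover have "Groth_class C x \<noteq> {}" "Groth_class C y \<noteq> {}"
    using assms self_in_Groth_class by blast+
  ultimately have "(\<Union>x' \<in> Groth_class C x. \<Union>y' \<in> Groth_class C y. Groth_class C (x' \<otimes>\<^bsub>Iso C\<^esub> y')) =
      Groth_class C (x \<otimes>\<^bsub>Iso C\<^esub> y)"
    by (intro SUP_eq_const)
  then show ?thesis by (simp add: Groth_def)
qed

section \<open>Singleton congruence classes\<close>

lemma Groth_class_eq_singletonI:
  assumes "x \<in> carrier (Iso C)" "\<And>y. (x, y) \<in> Ext1_rel C \<Longrightarrow> y = x"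
  shows "Groth_class C x = {x}"
proof -
  have "y = x" if "(x, y) \<in> (Ext1_rel C)\<^sup>+" for y
    using that by (induction rule: trancl_induct) (use assms(2) in blast)+
  then show ?thesis
    using self_in_Groth_class[OF assms(1)] by (auto simp: Groth_class_def Groth_cong_eq)
qed

text \<open>A sequence with zero middle term has zero ends, and every extension of zero by zero is
  zero. So only zero objects have trivial image in the Grothendieck monoid.\<close>

lemma Groth_class_zero: "Groth_class C (zero_class C) = {zero_class C}"
proof (rule Groth_class_eq_singletonI)
  show "zero_class C \<in> carrier (Iso C)" by (simp add: carrier_Iso zero_class_in_Iso)
  fix y assume "(zero_class C, y) \<in> Ext1_rel C"
  then obtain M N where "zero_class C \<in> Ext1 C M N" "y \<in> Ext1 C M N" by (auto simp: Ext1_rel_def)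
  then show "y = zero_class C"
    using zero_class_in_Ext1 Ext1_zero_right isoclass_zero_object by blast
qed

lemma almost_simple_Ext1:
  assumes "almost_simple C X" "isoclass C X \<in> Ext1 C A B" "A \<in> Ob C" "B \<in> Ob C"
  shows "isoclass C A = zero_class C \<and> isoclass C B = isoclass C X \<or>
    isoclass C B = zero_class C \<and> isoclass C A = isoclass C X"
  using assms by (auto simp: almost_simple_def doubleton_eq_iff)

text \<open>Any extension set containing \<open>[X]\<close> has one end zero and the other
  isomorphic to \<open>X\<close>, so all its members equal \<open>[X]\<close>.\<close>

lemma Groth_class_almost_simple:
  assumes "almost_simple C X"
  shows "Groth_class C (isoclass C X) = {isoclass C X}"
proof (rule Groth_class_eq_singletonI)
  show "isoclass C X \<in> carrier (Iso C)" using assms by (simp add: carrier_Iso almost_simple_def)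
  fix y assume "(isoclass C X, y) \<in> Ext1_rel C"
  then obtain M N where MN: "M \<in> Ob C" "N \<in> Ob C" "isoclass C X \<in> Ext1 C M N" "y \<in> Ext1 C M N"
    by (auto simp: Ext1_rel_def)
  then show "y = isoclass C X"
    using almost_simple_Ext1[OF assms MN(3,1,2)] Ext1_zero_left[OF MN(4)] Ext1_zero_right[OF MN(4)]
      isoclass_eq_zero_class_iff by metis
qed

section \<open>Almost simple objects and indecomposable elements\<close>

lemma Groth_class_almost_simple_indecomposable:
  assumes X: "almost_simple C X"
  shows "Groth_class C (isoclass C X) \<in> Groth_pos C - (Groth_pos C <#>\<^bsub>Groth C\<^esub> Groth_pos C)"
proof
  have x: "isoclass C X \<in> carrier (Iso C)" "isoclass C X \<noteq> zero_class C"
    using X isoclass_eq_zero_class_iff by (auto simp: carrier_Iso almost_simple_def)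
  then have "Groth_class C (isoclass C X) \<noteq> \<one>\<^bsub>Groth C\<^esub>"
    by (simp add: one_Groth Groth_class_zero Groth_class_almost_simple[OF X])
  then show "Groth_class C (isoclass C X) \<in> Groth_pos C"
    using x by (simp add: Groth_pos_def carrier_Groth)
  show "Groth_class C (isoclass C X) \<notin> Groth_pos C <#>\<^bsub>Groth C\<^esub> Groth_pos C"
  proof
    assume "Groth_class C (isoclass C X) \<in> Groth_pos C <#>\<^bsub>Groth C\<^esub> Groth_pos C"
    then obtain A B where AB: "A \<in> Ob C" "B \<in> Ob C"
      "Groth_class C (isoclass C A) \<noteq> \<one>\<^bsub>Groth C\<^esub>" "Groth_class C (isoclass C B) \<noteq> \<one>\<^bsub>Groth C\<^esub>"
      "Groth_class C (isoclass C X) = Groth_class C (isoclass C A) \<otimes>\<^bsub>Groth C\<^esub> Groth_class C (isoclass C B)"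
      by (auto simp: set_mult_def Groth_pos_def carrier_Groth carrier_Iso)
    obtain S iA iB pA pB where S: "is_biproduct C A B S iA iB pA pB"
      using ex_biproduct AB by metis
    have "Groth_class C (isoclass C X) = Groth_class C (isoclass C S)"
      using AB by (simp add: Groth_class_mult carrier_Iso Iso_mult_isoclass[OF S])
    then have "isoclass C S \<in> Groth_class C (isoclass C X)"
      using self_in_Groth_class[of "isoclass C S"] is_biproduct_arrows(3)[OF S]
      by (simp add: carrier_Iso)
    \<comment> \<open>As the class of \<open>X\<close> is a singleton, a decomposition in the
      Grothendieck monoid lifts to one of \<open>X\<close> itself, that is, to a split sequence with
      middle term \<open>X\<close>.\<close>
    then have "isoclass C S = isoclass C X"
      by (simp add: Groth_class_almost_simple[OF X])
    then have "isoclass C X \<in> Ext1 C A B" using biproduct_in_Ext1[OF S] by simp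
    then show False
      using almost_simple_Ext1[OF X _ AB(1,2)] AB(3,4) by (auto simp: one_Groth)
  qed
qed

lemma indecomposable_Groth_class_imp_almost_simple:
  assumes "X \<in> Ob C"
    and \<gamma>: "Groth_class C (isoclass C X) \<in> Groth_pos C - (Groth_pos C <#>\<^bsub>Groth C\<^esub> Groth_pos C)"
  shows "almost_simple C X"
  unfolding almost_simple_def
proof (intro conjI ballI impI)
  show "X \<in> Ob C" by fact
  show "\<not> is_zero_object C X"
    using \<gamma> isoclass_zero_object by (auto simp: Groth_pos_def one_Groth)
  fix A B assume AB: "A \<in> Ob C" "B \<in> Ob C" "isoclass C X \<in> Ext1 C A B"
  obtain S iA iB pA pB where S: "is_biproduct C A B S iA iB pA pB"
    using ex_biproduct AB by metis
  have cA: "isoclass C A \<in> carrier (Iso C)" and cB: "isoclass C B \<in> carrier (Iso C)"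
    using AB by (auto simp: carrier_Iso)
  \<comment> \<open>\<open>X\<close> and the split extension \<open>S\<close> have the same ends, so
    the sequence decomposes the class of \<open>X\<close>.\<close>
  have "(isoclass C X, isoclass C S) \<in> Groth_cong C"
    using biproduct_in_Ext1[OF S] AB unfolding Groth_cong_eq Ext1_rel_def by blast
  then have "Groth_class C (isoclass C X) = Groth_class C (isoclass C S)"
    unfolding Groth_class_def by (rule equiv_class_eq[OF equiv_Groth_cong])
  also have "\<dots> = Groth_class C (isoclass C A) \<otimes>\<^bsub>Groth C\<^esub> Groth_class C (isoclass C B)"
    using cA cB by (simp add: Groth_class_mult Iso_mult_isoclass[OF S])
  finally have eq: "Groth_class C (isoclass C X) =
    Groth_class C (isoclass C A) \<otimes>\<^bsub>Groth C\<^esub> Groth_class C (isoclass C B)" .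
  have "Groth_class C (isoclass C A) = \<one>\<^bsub>Groth C\<^esub> \<or> Groth_class C (isoclass C B) = \<one>\<^bsub>Groth C\<^esub>"
  proof (rule ccontr)
    assume "\<not> ?thesis"
    then have "Groth_class C (isoclass C A) \<in> Groth_pos C" "Groth_class C (isoclass C B) \<in> Groth_pos C"
      using cA cB by (auto simp: Groth_pos_def carrier_Groth)
    then show False using \<gamma> eq unfolding set_mult_def by blast
  qed
  \<comment> \<open>The trivial element contains only the class of zero objects, so a trivial image
    forces a zero object.\<close>
  then consider "isoclass C A = zero_class C" | "isoclass C B = zero_class C"
    using self_in_Groth_class[OF cA] self_in_Groth_class[OF cB] by (auto simp: one_Groth Groth_class_zero)
  then show "{isoclass C A, isoclass C B} = {isoclass C X, zero_class C}"
  proof cases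
    case 1
    then have "isoclass C X = isoclass C B"
      using Ext1_zero_left[OF AB(3)] isoclass_eq_zero_class_iff[OF AB(1)] by simp
    with 1 show ?thesis by auto
  next
    case 2
    then have "isoclass C X = isoclass C A"
      using Ext1_zero_right[OF AB(3)] isoclass_eq_zero_class_iff[OF AB(2)] by simp
    with 2 show ?thesis by auto
  qed
qed

lemma bij_betw_almost_simple_classes:
  "bij_betw (Groth_class C) (almost_simple_classes C)
    (Groth_pos C - (Groth_pos C <#>\<^bsub>Groth C\<^esub> Groth_pos C))"
proof (rule bij_betw_imageI)
  show "inj_on (Groth_class C) (almost_simple_classes C)"
    by (rule inj_onI) (auto simp: almost_simple_classes_def Groth_class_almost_simple)
  show "Groth_class C ` almost_simple_classes C =
    Groth_pos C - (Groth_pos C <#>\<^bsub>Groth C\<^esub> Groth_pos C)" (is "_ = ?I")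
  proof
    show "Groth_class C ` almost_simple_classes C \<subseteq> ?I"
      unfolding almost_simple_classes_def using Groth_class_almost_simple_indecomposable by blast
    show "?I \<subseteq> Groth_class C ` almost_simple_classes C"
    proof
      fix \<gamma> assume \<gamma>: "\<gamma> \<in> ?I"
      then obtain X where X: "X \<in> Ob C" "\<gamma> = Groth_class C (isoclass C X)"
        by (auto simp: Groth_pos_def carrier_Groth carrier_Iso)
      then show "\<gamma> \<in> Groth_class C ` almost_simple_classes C"
        using \<gamma> indecomposable_Groth_class_imp_almost_simple[OF X(1)]
        by (auto simp: almost_simple_classes_def)
    qed
  qed
qed

end

section \<open>The Hall algebra\<close>

text \<open>An element supported on \<open>c\<close> is its coefficient at \<open>c\<close> times
  the basis vector. The description by supports matches that of the grading.\<close>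

lemma Hall_span_single: "Hall.span {Poly_Mapping.single c 1} = {v. Poly_Mapping.keys v \<subseteq> {c}}"
proof -
  have "v = Hall_scale (Poly_Mapping.lookup v c) (Poly_Mapping.single c 1)"
    if "Poly_Mapping.keys v \<subseteq> {c}" for v
    using that by (intro poly_mapping_eqI) (auto simp: lookup_single when_def in_keys_iff)
  moreover have "Poly_Mapping.keys (Hall_scale q (Poly_Mapping.single c 1)) \<subseteq> {c}" for q
    by (auto simp: in_keys_iff lookup_single when_def split: if_splits)
  ultimately show ?thesis unfolding Hall.span_singleton by blast
qed

lemma Hall_dim_span_single: "Hall.dim (Hall.span {Poly_Mapping.single c 1}) = 1"
proof -
  have "Poly_Mapping.single c (1 :: rat) \<noteq> 0"
    by (metis lookup_single_eq lookup_zero zero_neq_one)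
  then have "Hall.independent {Poly_Mapping.single c 1}" by simp
  from Hall.dim_span_eq_card_independent[OF this] show ?thesis by (simp del: Hall.dim_span)
qed

context exact_category
begin

section \<open>Counting sequences with a zero end\<close>

text \<open>The monomorphism is an automorphism since the quotient is zero, and the epimorphism is
  forced. Conversely each automorphism arises by transporting the split sequence along it.\<close>

lemma Seqs_zero_left:
  assumes "X \<in> Ob C" "is_zero_object C Z"
  shows "Seqs C Z X X = (\<lambda>i. (i, Zro C X Z)) ` Aut C X"
proof -
  have [simp]: "X \<in> Ob C" "Z \<in> Ob C" using assms by (auto simp: is_zero_object_def)
  have "i \<in> Aut C X \<and> j = Zro C X Z" if "(i, j) \<in> Seqs C Z X X" for i j
  proof -
    have ij: "(i, j) \<in> Ses C" "Dom C i = X" "Cod C i = X" "Cod C j = Z"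
      using that by (auto simp: Seqs_iff)
    then have "is_iso C i" using Ses_zero_right_is_iso[OF ij(1)] assms(2) by simp
    moreover have "j = Zro C X Z"
      using assms(2) by (rule Mor_to_zero_object) (simp add: Mor_iff ij Ses_arrows[OF ij(1)])
    ultimately show ?thesis by (simp add: Aut_def Mor_iff ij Ses_arrows[OF ij(1)])
  qed
  moreover have "(i, Zro C X Z) \<in> Seqs C Z X X" if "i \<in> Aut C X" for i
  proof -
    have i: "i \<in> Ar C" "Dom C i = X" "Cod C i = X" "is_iso C i" using that by (auto simp: Aut_def Mor_iff)
    have "(i, Zro C X Z) \<in> Ses C"
      by (rule Ses_iso[OF Ses_split[OF is_biproduct_zero[OF assms]],
            where b = "Idn C X" and x = i and a = "Idn C Z"]) (simp_all add: Mor_iff i is_iso_Idn)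
    then show ?thesis using i by (simp add: Seqs_iff)
  qed
  ultimately show ?thesis by auto
qed

lemma Seqs_zero_right:
  assumes "X \<in> Ob C" "is_zero_object C Z"
  shows "Seqs C X Z X = (\<lambda>j. (Zro C Z X, j)) ` Aut C X"
proof -
  have [simp]: "X \<in> Ob C" "Z \<in> Ob C" using assms by (auto simp: is_zero_object_def)
  have "j \<in> Aut C X \<and> i = Zro C Z X" if "(i, j) \<in> Seqs C X Z X" for i j
  proof -
    have ij: "(i, j) \<in> Ses C" "Dom C i = Z" "Cod C i = X" "Cod C j = X"
      using that by (auto simp: Seqs_iff)
    then have "is_iso C j" using Ses_zero_left_is_iso[OF ij(1)] assms(2) by simp
    moreover have "i = Zro C Z X"
      using assms(2) by (rule Mor_from_zero_object) (simp add: Mor_iff ij Ses_arrows[OF ij(1)])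
    ultimately show ?thesis by (simp add: Aut_def Mor_iff ij Ses_arrows[OF ij(1)])
  qed
  moreover have "(Zro C Z X, j) \<in> Seqs C X Z X" if "j \<in> Aut C X" for j
  proof -
    have j: "j \<in> Ar C" "Dom C j = X" "Cod C j = X" "is_iso C j" using that by (auto simp: Aut_def Mor_iff)
    have "(Zro C Z X, j) \<in> Ses C"
      by (rule Ses_iso[OF Ses_split[OF is_biproduct_swap[OF is_biproduct_zero[OF assms]]],
            where b = "Idn C Z" and x = "Idn C X" and a = j]) (simp_all add: Mor_iff j is_iso_Idn)
    then show ?thesis using j by (simp add: Seqs_iff)
  qed
  ultimately show ?thesis by auto
qed

lemma card_Seqs_zero:
  assumes "X \<in> Ob C" "is_zero_object C Z"
  shows "card (Seqs C Z X X) = card (Aut C X)" "card (Seqs C X Z X) = card (Aut C X)"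
  unfolding Seqs_zero_left[OF assms] Seqs_zero_right[OF assms]
  by (auto intro!: card_image inj_onI)

lemma card_Aut_pos:
  assumes "finitary C" "X \<in> Ob C"
  shows "card (Aut C X) > 0"
proof -
  have "finite (Aut C X)"
    using assms by (auto simp: finitary_def Aut_def)
  moreover have "Idn C X \<in> Aut C X"
    using assms(2) by (simp add: Aut_def Mor_iff is_iso_Idn)
  ultimately show ?thesis by (auto simp: card_gt_0_iff)
qed

text \<open>The automorphism counts of \<open>a\<close> and \<open>b\<close> cancel against the
  denominator of \<open>Hall_num\<close>; finiteness ensures that they are nonzero.\<close>

lemma dual_Hall_num_eq:
  assumes "finitary C" "a \<in> carrier (Iso C)" "b \<in> carrier (Iso C)"
  shows "dual_Hall_num C a b c =
    of_nat (card (Seqs C (rep b) (rep a) (rep c))) / of_nat (card (Aut C (rep c)))"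
proof -
  have "card (Aut C (rep a)) > 0" "card (Aut C (rep b)) > 0"
    using assms isoclass_rep(1) by (auto simp: carrier_Iso intro!: card_Aut_pos)
  then show ?thesis by (simp add: dual_Hall_num_def Hall_num_def)
qed

text \<open>Almost simplicity leaves only sequences with one zero end. These are counted by the
  automorphisms of the middle term, which cancels the remaining denominator.\<close>

lemma dual_Hall_num_almost_simple:
  assumes fin: "finitary C" and X: "almost_simple C X"
    and a: "a \<in> carrier (Iso C)" and b: "b \<in> carrier (Iso C)"
  shows "dual_Hall_num C a b (isoclass C X) =
    (if a = isoclass C X \<and> b = zero_class C \<or> a = zero_class C \<and> b = isoclass C X then 1 else 0)"
proof -
  define c where "c = isoclass C X"
  have c: "c \<in> carrier (Iso C)" using X by (auto simp: c_def carrier_Iso almost_simple_def)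
  note rep = isoclass_rep[OF a[unfolded carrier_Iso]] isoclass_rep[OF b[unfolded carrier_Iso]]
    isoclass_rep[OF c[unfolded carrier_Iso]]
  have zero: "is_zero_object C (rep (zero_class C))"
    using isoclass_rep[OF zero_class_in_Iso] isoclass_eq_zero_class_iff by blast
  have pos: "card (Aut C (rep c)) > 0" using fin rep(5) by (rule card_Aut_pos)
  have "Seqs C (rep b) (rep a) (rep c) = {}"
    if "\<not> (a = c \<and> b = zero_class C \<or> a = zero_class C \<and> b = c)"
  proof (rule ccontr)
    assume "Seqs C (rep b) (rep a) (rep c) \<noteq> {}"
    then have "isoclass C (rep c) \<in> Ext1 C (rep b) (rep a)"
      using rep(5) unfolding Ext1_def by blast
    then show False
      using almost_simple_Ext1[OF X, of "rep b" "rep a"] rep that by (auto simp: c_def)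
  qed
  moreover have "card (Seqs C (rep b) (rep a) (rep c)) = card (Aut C (rep c))"
    if "a = c \<and> b = zero_class C \<or> a = zero_class C \<and> b = c"
    using that card_Seqs_zero[OF rep(5) zero] by auto
  ultimately show ?thesis
    using pos unfolding dual_Hall_num_eq[OF fin a b] c_def[symmetric] by auto
qed

section \<open>Primitivity and dimension of the graded parts\<close>

lemma Hall_graded_almost_simple:
  assumes X: "almost_simple C X"
  shows "Hall_graded C (Groth_class C (isoclass C X)) = {v. Poly_Mapping.keys v \<subseteq> {isoclass C X}}"
proof -
  have c: "isoclass C X \<in> carrier (Iso C)" using X by (auto simp: carrier_Iso almost_simple_def)
  have "x = isoclass C X"
    if "x \<in> carrier (Iso C)" "Groth_class C x = Groth_class C (isoclass C X)" for x
    using self_in_Groth_class[OF that(1)] that(2) Groth_class_almost_simple[OF X] by simp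
  then show ?thesis
    using c by (auto simp: Hall_graded_def Hall_def)
qed

lemma almost_simple_primitive:
  assumes fin: "finitary C" and X: "almost_simple C X"
    and v: "Poly_Mapping.keys v \<subseteq> {isoclass C X}"
  shows "v \<in> Hall_Prim C"
proof -
  define c where "c = isoclass C X"
  have c: "c \<in> carrier (Iso C)" "c \<noteq> zero_class C"
    using X isoclass_eq_zero_class_iff by (auto simp: c_def carrier_Iso almost_simple_def)
  have z: "zero_class C \<in> carrier (Iso C)" by (simp add: carrier_Iso zero_class_in_Iso)
  have lookup_v: "Poly_Mapping.lookup v x = (if x = c then Poly_Mapping.lookup v c else 0)" for x
    using v by (auto simp: c_def in_keys_iff)
  have "Hall_comult C v (a, b) = Hall_tensor v (Hall_one C) (a, b) + Hall_tensor (Hall_one C) v (a, b)"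
    for a b
  proof -
    \<comment> \<open>The support of \<open>v\<close> is empty when \<open>v\<close> is zero;
      summing over \<open>{c}\<close> treats both cases at once.\<close>
    have "(\<Sum>x \<in> Poly_Mapping.keys v. Poly_Mapping.lookup v x * dual_Hall_num C a b x) =
        (\<Sum>x \<in> {c}. Poly_Mapping.lookup v x * dual_Hall_num C a b x)"
      using v by (intro sum.mono_neutral_left) (auto simp: c_def in_keys_iff)
    also have "\<dots> = Poly_Mapping.lookup v c * dual_Hall_num C a b c" by simp
    finally have "Hall_comult C v (a, b) =
      (if a \<in> carrier (Iso C) \<and> b \<in> carrier (Iso C)
       then Poly_Mapping.lookup v c * dual_Hall_num C a b c else 0)"
      by (simp add: Hall_comult_def)
    also have "\<dots> = (if a = c \<and> b = zero_class C \<or> a = zero_class C \<and> b = c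
       then Poly_Mapping.lookup v c else 0)"
      using dual_Hall_num_almost_simple[OF fin X, of a b] c z by (auto simp: c_def)
    \<comment> \<open>Because \<open>c\<close> is not the zero class, the two tensors have disjoint
      supports and no coefficient is counted twice.\<close>
    also have "\<dots> = Hall_tensor v (Hall_one C) (a, b) + Hall_tensor (Hall_one C) v (a, b)"
      using c(2) lookup_v[of a] lookup_v[of b]
      by (auto simp: Hall_tensor_def Hall_one_def one_Iso lookup_single when_def)
    finally show ?thesis .
  qed
  then show ?thesis
    using v c(1) by (auto simp: Hall_Prim_def Hall_def c_def)
qed

lemma Hall_graded_indecomposable:
  assumes fin: "finitary C"
    and \<gamma>: "\<gamma> \<in> Groth_pos C - (Groth_pos C <#>\<^bsub>Groth C\<^esub> Groth_pos C)"
  shows "Hall_graded C \<gamma> = Hall_Prim_graded C \<gamma>" "Hall.dim (Hall_graded C \<gamma>) = 1"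
proof -
  obtain X where X: "almost_simple C X" "\<gamma> = Groth_class C (isoclass C X)"
    using \<gamma> bij_betw_imp_surj_on[OF bij_betw_almost_simple_classes]
    by (auto simp: almost_simple_classes_def)
  show "Hall_graded C \<gamma> = Hall_Prim_graded C \<gamma>"
    using almost_simple_primitive[OF fin X(1)] Hall_graded_almost_simple[OF X(1)]
    unfolding Hall_Prim_graded_def X(2) by blast
  show "Hall.dim (Hall_graded C \<gamma>) = 1"
    unfolding X(2) Hall_graded_almost_simple[OF X(1)] Hall_span_single[symmetric]
    by (rule Hall_dim_span_single)
qed

end

theorem lemma5p3:
  fixes C :: "('o, 'm) excat"
  assumes "exact_category C"
  shows "bij_betw (Groth_class C) (almost_simple_classes C)
           (Groth_pos C - (Groth_pos C <#>\<^bsub>Groth C\<^esub> Groth_pos C)) \<and>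
         (finitary C \<longrightarrow>
           (\<forall>\<gamma> \<in> Groth_pos C - (Groth_pos C <#>\<^bsub>Groth C\<^esub> Groth_pos C).
              Hall_graded C \<gamma> = Hall_Prim_graded C \<gamma> \<and> Hall.dim (Hall_graded C \<gamma>) = 1))"
  using exact_category.bij_betw_almost_simple_classes[OF assms]
    exact_category.Hall_graded_indecomposable[OF assms] by blast

end
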